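(* Let $G$ be a graph, $\theta$ a real number, and $X \subseteq V(G)$ with $|X|>1$. The following are equivalent: (a) $X$ is a maximal $\theta$-Tutte set in $G$ (maximal under inclusion among $\theta$-Tutte sets); (b) $X$ is a maximal $\theta$-extreme set in $G$ (maximal under inclusion among $\theta$-extreme sets); (c) $X$ is a maximal $\theta$-nice set in $G$, i.e. $\mathrm{mult}(\theta, G\setminus \{u,v\})=\mathrm{mult}(\theta,G)+2$ for all distinct $u,v\in X$, and no proper superset of $X$ has this property.
   Context: All graphs are finite and simple. For a graph $G$ on $n$ vertices, let $p(G,r)$ be the number of $r$-matchings of $G$ ($p(G,0)=1$); the matching polynomial is $\mu(G,x)=\sum_{r=0}^{\lfloor n/2\rfloor}(-1)^r p(G,r)x^{n-2r}$ (the graph with no vertices has $\mu=1$). For real $\theta$, $\mathrm{mult}(\theta,G)$ is the multiplicity of $\theta$ as a root of $\mu(G,x)$ (it is $0$ if $\theta$ is not a root). For $X\subseteq V(G)$, $G\setminus X$ is the graph obtained by deleting the vertices of $X$ and their incident edges; $G\setminus u$, $G\setminus uv$ mean $G\setminus\{u\}$, $G\setminus\{u,v\}$. A vertex $u$ is $\theta$-essential in $G$ if $\mathrm{mult}(\theta,G\setminus u)=\mathrm{mult}(\theta,G)-1$. A connected graph is $\theta$-critical if every one of its vertices is $\theta$-essential in it; $c_\theta(G)$ denotes the number of connected components of $G$ that are $\theta$-critical. A set $X\subseteq V(G)$ is a $\theta$-Tutte set if $c_\theta(G\setminus X)=\mathrm{mult}(\theta,G)+|X|$, and a $\theta$-extreme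 set if $\mathrm{mult}(\theta,G\setminus X)=\mathrm{mult}(\theta,G)+|X|$. *)

theory Defs
  imports "HOL-Computational_Algebra.Polynomial"
begin

type_synonym 'a graph = "'a set \<times> 'a set set"

definition verts :: "'a graph \<Rightarrow> 'a set" where "verts G = fst G"
definition edges :: "'a graph \<Rightarrow> 'a set set" where "edges G = snd G"

definition simple_graph :: "'a graph \<Rightarrow> bool" where
  "simple_graph G \<longleftrightarrow> finite (verts G) \<and>
     (\<forall>e\<in>edges G. \<exists>u v. e = {u, v} \<and> u \<noteq> v \<and> u \<in> verts G \<and> v \<in> verts G)"

definition del :: "'a graph \<Rightarrow> 'a set \<Rightarrow> 'a graph" where
  "del G X = (verts G - X, {e \<in> edges G. e \<inter> X = {}})"

definition matchings :: "'a graph \<Rightarrow> nat \<Rightarrow> 'a set set set" where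
  "matchings G r = {M. M \<subseteq> edges G \<and> card M = r \<and>
       (\<forall>e\<in>M. \<forall>f\<in>M. e \<noteq> f \<longrightarrow> e \<inter> f = {})}"

definition pmatch :: "'a graph \<Rightarrow> nat \<Rightarrow> nat" where
  "pmatch G r = card (matchings G r)"

definition match_poly :: "'a graph \<Rightarrow> real poly" where
  "match_poly G = (\<Sum>r\<le>card (verts G) div 2.
      monom ((-1) ^ r * real (pmatch G r)) (card (verts G) - 2 * r))"

definition mult :: "real \<Rightarrow> 'a graph \<Rightarrow> nat" where
  "mult \<theta> G = order \<theta> (match_poly G)"

definition essential :: "real \<Rightarrow> 'a graph \<Rightarrow> 'a \<Rightarrow> bool" where
  "essential \<theta> G u \<longleftrightarrow> int (mult \<theta> (del G {u})) = int (mult \<theta> G) - 1"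

definition reach :: "'a graph \<Rightarrow> 'a \<Rightarrow> 'a \<Rightarrow> bool" where
  "reach G = (\<lambda>x y. {x, y} \<in> edges G)\<^sup>*\<^sup>*"

definition connected_graph :: "'a graph \<Rightarrow> bool" where
  "connected_graph G \<longleftrightarrow> verts G \<noteq> {} \<and> (\<forall>u\<in>verts G. \<forall>v\<in>verts G. reach G u v)"

definition critical :: "real \<Rightarrow> 'a graph \<Rightarrow> bool" where
  "critical \<theta> G \<longleftrightarrow> connected_graph G \<and> (\<forall>u\<in>verts G. essential \<theta> G u)"

definition components :: "'a graph \<Rightarrow> 'a set set" where
  "components G = {{u \<in> verts G. reach G v u} | v. v \<in> verts G}"

definition induced :: "'a graph \<Rightarrow> 'a set \<Rightarrow> 'a graph" where
  "induced G C = (C, {e \<in> edges G. e \<subseteq> C})"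

definition c_crit :: "real \<Rightarrow> 'a graph \<Rightarrow> nat" where
  "c_crit \<theta> G = card {C \<in> components G. critical \<theta> (induced G C)}"

definition tutte_set :: "real \<Rightarrow> 'a graph \<Rightarrow> 'a set \<Rightarrow> bool" where
  "tutte_set \<theta> G X \<longleftrightarrow> X \<subseteq> verts G \<and> c_crit \<theta> (del G X) = mult \<theta> G + card X"

definition extreme_set :: "real \<Rightarrow> 'a graph \<Rightarrow> 'a set \<Rightarrow> bool" where
  "extreme_set \<theta> G X \<longleftrightarrow> X \<subseteq> verts G \<and> mult \<theta> (del G X) = mult \<theta> G + card X"

definition nice_set :: "real \<Rightarrow> 'a graph \<Rightarrow> 'a set \<Rightarrow> bool" where
  "nice_set \<theta> G X \<longleftrightarrow> X \<subseteq> verts G \<and>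
     (\<forall>u\<in>X. \<forall>v\<in>X. u \<noteq> v \<longrightarrow> mult \<theta> (del G {u, v}) = mult \<theta> G + 2)"

definition maximal_wrt :: "('a set \<Rightarrow> bool) \<Rightarrow> 'a graph \<Rightarrow> 'a set \<Rightarrow> bool" where
  "maximal_wrt P G X \<longleftrightarrow> P X \<and> (\<forall>Y. X \<subset> Y \<and> Y \<subseteq> verts G \<longrightarrow> \<not> P Y)"

end

(*
  Give every vertex v a loop of weight w v, replacing x by x + w v in the matching polynomial. Both
    f' f_u - f f_u' >= f_u^2   and   f_u f_v - f f_uv >= 0   (even >= f_uv^2 if u and v are adjacent)
  survive, pointwise on the real line. Comparing orders of vanishing and leading coefficients at theta,
  they give interlacing, parity constraints on multiplicities, and signs. Perturbing the loop weights at
  one or two vertices changes f by multiples of f_u, f_v and f_uv, so contradictions come from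
  cancelling a leading coefficient.

  A Tutte set is extreme because every critical component has multiplicity 1. A maximal extreme set X
  is Tutte because no vertex of G - X raises the multiplicity, while a vertex that is not essential but
  adjacent to an essential one does. So every component of G - X with root theta is critical.

  Nice sets of size at least 2 are extreme by induction, once it is known for triples.
*)
theory Submission
  imports Defs
begin

subsection \<open>Matching polynomials with loop weights\<close>

text \<open>\<open>E\<close> stays fixed throughout and deleting vertices only shrinks
  \<open>S\<close>; the filter discards members of \<open>E\<close> that are not 2-subsets of
  \<open>S\<close>.\<close>

definition matchings_on :: "'a set set \<Rightarrow> 'a set \<Rightarrow> 'a set set set" where
  "matchings_on E S = {M. M \<subseteq> {e \<in> E. e \<subseteq> S \<and> card e = 2} \<and> pairwise disjnt M}"

text \<open>For \<open>w\<close> constantly 0 and \<open>S\<close> the vertex set of a simple graph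
  this is the ordinary matching polynomial, as \<open>match_poly_eq_wpoly\<close> shows.\<close>

definition wpoly :: "'a set set \<Rightarrow> ('a \<Rightarrow> real) \<Rightarrow> 'a set \<Rightarrow> real poly" where
  "wpoly E w S = (\<Sum>M\<in>matchings_on E S. (-1) ^ card M * (\<Prod>v\<in>S - \<Union>M. [:w v, 1:]))"

definition nbrs :: "'a set set \<Rightarrow> 'a set \<Rightarrow> 'a \<Rightarrow> 'a set" where
  "nbrs E S u = {v \<in> S - {u}. {u, v} \<in> E}"

lemma finite_matchings_on: "finite S \<Longrightarrow> finite (matchings_on E S)"
  by (rule finite_subset[of _ "Pow (Pow S)"]) (auto simp: matchings_on_def)

lemma finite_nbrs [simp]: "finite S \<Longrightarrow> finite (nbrs E S u)"
  by (simp add: nbrs_def)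

lemma matchings_on_split:
  assumes "u \<in> S"
  shows "matchings_on E S = matchings_on E (S - {u}) \<union>
    (\<Union>v\<in>nbrs E S u. insert {u, v} ` matchings_on E (S - {u, v}))" (is "?L = ?A \<union> ?B")
proof (intro equalityI subsetI)
  fix M assume M: "M \<in> ?L"
  show "M \<in> ?A \<union> ?B"
  proof (cases "u \<in> \<Union>M")
    case False
    then show ?thesis using M by (auto simp: matchings_on_def)
  next
    case True
    then obtain e where e: "e \<in> M" "u \<in> e" by auto
    with M have "card e = 2" "e \<subseteq> S" "e \<in> E" by (auto simp: matchings_on_def)
    then obtain v where v: "e = {u, v}" "v \<noteq> u"
      using e(2) by (auto simp: card_2_iff)
    have dj: "e \<inter> f = {}" if "f \<in> M - {e}" for f
      using M e(1) that unfolding matchings_on_def pairwise_def disjnt_def by blast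
    have "M - {e} \<in> matchings_on E (S - {u, v})"
      using M dj v unfolding matchings_on_def pairwise_def by blast
    moreover have "M = insert {u, v} (M - {e})" using e v by auto
    moreover have "v \<in> nbrs E S u" using v \<open>e \<subseteq> S\<close> \<open>e \<in> E\<close> by (auto simp: nbrs_def)
    ultimately show ?thesis by blast
  qed
next
  fix M assume "M \<in> ?A \<union> ?B"
  then show "M \<in> ?L"
  proof
    assume "M \<in> ?B"
    then obtain v N where vN: "v \<in> nbrs E S u" "N \<in> matchings_on E (S - {u, v})" "M = insert {u, v} N"
      by blast
    then have "disjnt {u, v} f \<and> disjnt f {u, v}" if "f \<in> N" for f
      using that by (auto simp: matchings_on_def disjnt_def)
    then show ?thesis
      using vN assms by (auto simp: matchings_on_def nbrs_def pairwise_insert)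
  qed (auto simp: matchings_on_def)
qed

text \<open>Sort the matchings by what happens at \<open>u\<close>. Uncovered, \<open>u\<close>
  gives the factor x + \<open>w u\<close>; matched to \<open>v\<close>, removal of the edge flips
  the sign.\<close>

lemma wpoly_rec:
  assumes fin: "finite S" and u: "u \<in> S"
  shows "wpoly E w S = [:w u, 1:] * wpoly E w (S - {u}) - (\<Sum>v\<in>nbrs E S u. wpoly E w (S - {u, v}))"
proof -
  define t where "t = (\<lambda>S M. (-1) ^ card M * (\<Prod>v\<in>S - \<Union>M. [:w v, 1:]) :: real poly)"
  let ?I = "\<lambda>v. insert {u, v} ` matchings_on E (S - {u, v})"
  have fm: "finite (matchings_on E (S - X))" for X
    using fin by (simp add: finite_matchings_on)
  have mem: "u \<notin> \<Union>M" "v \<notin> \<Union>M" if "M \<in> matchings_on E (S - {u, v})" for v M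
    using that by (auto simp: matchings_on_def)
  have fM: "finite M" if "M \<in> matchings_on E (S - X)" for X M
    using that fin by (auto simp: matchings_on_def intro!: finite_subset[of M "Pow S"])
  have part1: "(\<Sum>M\<in>matchings_on E (S - {u}). t S M) = [:w u, 1:] * wpoly E w (S - {u})"
    unfolding wpoly_def sum_distrib_left
  proof (rule sum.cong[OF refl])
    fix M assume M: "M \<in> matchings_on E (S - {u})"
    have "S - \<Union>M = insert u (S - {u} - \<Union>M)" using M u by (auto simp: matchings_on_def)
    then have "(\<Prod>v\<in>S - \<Union>M. [:w v, 1:]) = [:w u, 1:] * (\<Prod>v\<in>S - {u} - \<Union>M. [:w v, 1:])"
      using fin by (simp del: mult_pCons_left)
    then show "t S M = [:w u, 1:] * ((-1) ^ card M * (\<Prod>v\<in>S - {u} - \<Union>M. [:w v, 1:]))"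
      by (simp add: t_def mult.left_commute del: mult_pCons_left)
  qed
  have part2: "(\<Sum>M\<in>?I v. t S M) = - wpoly E w (S - {u, v})" if v: "v \<in> nbrs E S u" for v
  proof -
    have inj: "inj_on (insert {u, v}) (matchings_on E (S - {u, v}))"
      using mem unfolding inj_on_def by (metis UnionI insertCI insert_ident)
    have "t S (insert {u, v} M) = - t (S - {u, v}) M" if M: "M \<in> matchings_on E (S - {u, v})" for M
    proof -
      have "{u, v} \<notin> M" using mem[OF M] by auto
      moreover have "S - \<Union>(insert {u, v} M) = S - {u, v} - \<Union>M" by auto
      ultimately show ?thesis using fM[OF M] by (simp add: t_def)
    qed
    then show ?thesis
      by (simp add: sum.reindex[OF inj] t_def wpoly_def sum_negf)
  qed
  have "wpoly E w S = (\<Sum>M\<in>matchings_on E (S - {u}) \<union> (\<Union>v\<in>nbrs E S u. ?I v). t S M)"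
    by (simp add: wpoly_def t_def flip: matchings_on_split[OF u])
  also have "\<dots> = (\<Sum>M\<in>matchings_on E (S - {u}). t S M) + (\<Sum>M\<in>(\<Union>v\<in>nbrs E S u. ?I v). t S M)"
    using fin fm by (intro sum.union_disjoint) (auto simp: matchings_on_def)
  also have "(\<Sum>M\<in>(\<Union>v\<in>nbrs E S u. ?I v). t S M) = (\<Sum>v\<in>nbrs E S u. \<Sum>M\<in>?I v. t S M)"
  proof (intro sum.UNION_disjoint ballI impI)
    fix a b assume ab: "a \<in> nbrs E S u" "b \<in> nbrs E S u" "a \<noteq> b"
    show "?I a \<inter> ?I b = {}"
    proof (rule ccontr)
      assume "?I a \<inter> ?I b \<noteq> {}"
      then obtain M N where "M \<in> matchings_on E (S - {u, a})" "N \<in> matchings_on E (S - {u, b})"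
        "insert {u, a} M = insert {u, b} N" by blast
      moreover from this have "{u, a} \<in> insert {u, b} N" by blast
      ultimately show False using ab mem(1)[of N b] by (auto simp: nbrs_def doubleton_eq_iff)
    qed
  qed (use fin fm in auto)
  finally show ?thesis by (simp add: part1 part2 sum_negf)
qed

lemma wpoly_empty [simp]: "wpoly E w {} = 1"
proof -
  have "matchings_on E {} = {{}}" by (auto simp: matchings_on_def pairwise_def)
  then show ?thesis by (simp add: wpoly_def)
qed

lemma wpoly_cong:
  assumes "\<And>v. v \<in> S \<Longrightarrow> w v = w' v" and "\<And>e. e \<subseteq> S \<Longrightarrow> e \<in> E \<longleftrightarrow> e \<in> E'"
  shows "wpoly E w S = wpoly E' w' S"
proof -
  have "matchings_on E S = matchings_on E' S"
    using assms(2) unfolding matchings_on_def by blast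
  then show ?thesis using assms(1) unfolding wpoly_def by (intro sum.cong) auto
qed

lemma wpoly_upd_notin: "u \<notin> S \<Longrightarrow> wpoly E (w(u := a)) S = wpoly E w S"
  by (rule wpoly_cong) auto

text \<open>In the recursion at \<open>u\<close> only the factor x + \<open>w u\<close> involves the
  weight of \<open>u\<close>, so f is affine in that weight with slope f_u. Every later cancellation
  of a leading coefficient rests on this.\<close>

lemma wpoly_upd:
  assumes "finite S" "u \<in> S"
  shows "wpoly E (w(u := w u + a)) S = wpoly E w S + smult a (wpoly E w (S - {u}))"
proof -
  have *: "[:w u + a, 1:] * p = [:w u, 1:] * p + smult a p" for p :: "real poly"
    by (simp add: smult_add_left)
  show ?thesis
    unfolding wpoly_rec[OF assms, of E "w(u := w u + a)"] wpoly_rec[OF assms, of E w]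
    using * by (simp add: wpoly_upd_notin del: mult_pCons_left)
qed

text \<open>Serves to show that f is nonzero, so that orders of vanishing make sense. The degree
  bound is carried along so that the neighbour terms of the recursion cannot reach the top
  coefficient.\<close>

lemma wpoly_monic:
  "finite S \<Longrightarrow> degree (wpoly E w S) \<le> card S \<and> coeff (wpoly E w S) (card S) = 1"
proof (induction "card S" arbitrary: S rule: less_induct)
  case less
  show ?case
  proof (cases "S = {}")
    case False
    then obtain u where u: "u \<in> S" by auto
    define n where "n = card (S - {u})"
    have cS: "card S = Suc n" using u less.prems by (simp add: card.remove n_def del: card_Diff_insert)
    have IH: "degree (wpoly E w (S - {u})) \<le> n" "coeff (wpoly E w (S - {u})) n = 1"
      using less.hyps[of "S - {u}"] less.prems cS by (simp_all add: n_def[symmetric])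
    have nb: "degree (wpoly E w (S - {u, v})) < Suc n" for v
    proof -
      have "card (S - {u, v}) < card S" using u less.prems by (intro psubset_card_mono) auto
      then show ?thesis using less.hyps[of "S - {u, v}"] less.prems cS by simp
    qed
    have l: "degree ([:w u, 1:] * wpoly E w (S - {u})) \<le> Suc n"
      using IH(1) degree_mult_le[of "[:w u, 1:]" "wpoly E w (S - {u})"] by simp
    have s: "degree (\<Sum>v\<in>nbrs E S u. wpoly E w (S - {u, v})) < Suc n"
      by (rule degree_sum_less) (use nb in auto)
    have "coeff ([:w u, 1:] * wpoly E w (S - {u})) (Suc n) = 1"
      using IH by (simp add: coeff_eq_0)
    then show ?thesis
      unfolding wpoly_rec[OF less.prems u] cS using l s
      by (auto simp: coeff_eq_0 intro!: degree_diff_le simp del: mult_pCons_left)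
  qed auto
qed

lemma wpoly_nonzero: "finite S \<Longrightarrow> wpoly E w S \<noteq> 0"
  using wpoly_monic[of S E w] by auto

section \<open>Derivatives, disjoint unions and the two pointwise inequalities\<close>

lemma pderiv_sum: "pderiv (\<Sum>x\<in>A. f x) = (\<Sum>x\<in>A. pderiv (f x))"
  by (induction A rule: infinite_finite_induct) (auto simp: pderiv_add)

text \<open>Differentiate the recursion at \<open>u\<close>. The derivative of the linear factor
  gives f_u, and by induction the remaining terms, grouped by the deleted vertex \<open>z\<close>,
  reassemble into the recursion for \<open>S - {z}\<close>.\<close>

lemma pderiv_wpoly:
  "finite S \<Longrightarrow> pderiv (wpoly E w S) = (\<Sum>u\<in>S. wpoly E w (S - {u}))"
proof (induction "card S" arbitrary: S rule: less_induct)
  case less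
  show ?case
  proof (cases "S = {}")
    case False
    then obtain u where u: "u \<in> S" by auto
    let ?f = "wpoly E w" and ?l = "[:w u, 1:]"
    have IH: "pderiv (?f (S - X)) = (\<Sum>z\<in>S - X. ?f (S - insert z X))" if "u \<in> X" for X
    proof -
      have "card (S - X) < card S" using u less.prems that by (intro psubset_card_mono) auto
      then have "pderiv (?f (S - X)) = (\<Sum>z\<in>S - X. ?f (S - X - {z}))"
        by (rule less.hyps) (use less.prems in simp)
      moreover have "S - X - {z} = S - insert z X" for z by auto
      ultimately show ?thesis by simp
    qed
    have "pderiv (?f S) = ?f (S - {u}) + ?l * pderiv (?f (S - {u}))
        - (\<Sum>v\<in>nbrs E S u. pderiv (?f (S - {u, v})))"
      unfolding wpoly_rec[OF less.prems u, of E w]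
      by (simp only: pderiv_diff pderiv_mult pderiv_sum) (simp add: pderiv_pCons)
    also have "(\<Sum>v\<in>nbrs E S u. pderiv (?f (S - {u, v})))
        = (\<Sum>v\<in>nbrs E S u. \<Sum>z\<in>S - {u, v}. ?f (S - {z, u, v}))"
      by (simp add: IH)
    \<comment> \<open>Choosing the neighbour \<open>v\<close> and then \<open>z\<close>, or
      \<open>z\<close> and then \<open>v\<close>, leaves the same condition that \<open>z\<close>
      and \<open>v\<close> differ.\<close>
    also have "\<dots> = (\<Sum>z\<in>S - {u}. \<Sum>v\<in>nbrs E (S - {z}) u. ?f (S - {z, u, v}))"
    proof -
      have "S - {u, v} = {z \<in> S - {u}. z \<noteq> v}" for v by auto
      moreover have "nbrs E (S - {z}) u = {v \<in> nbrs E S u. z \<noteq> v}" for z by (auto simp: nbrs_def)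
      ultimately show ?thesis
        using less.prems by (simp only: sum.swap_restrict[OF finite_nbrs finite_Diff])
    qed
    also have "pderiv (?f (S - {u})) = (\<Sum>z\<in>S - {u}. ?f (S - {z, u}))"
      by (simp add: IH)
    finally have "pderiv (?f S) = ?f (S - {u}) + (\<Sum>z\<in>S - {u}. ?l * ?f (S - {z, u})
        - (\<Sum>v\<in>nbrs E (S - {z}) u. ?f (S - {z, u, v})))"
      by (simp only: sum_distrib_left sum_subtractf add_diff_eq)
    also have "\<dots> = ?f (S - {u}) + (\<Sum>z\<in>S - {u}. ?f (S - {z}))"
    proof -
      have "?f (S - {z}) = ?l * ?f (S - {z, u}) - (\<Sum>v\<in>nbrs E (S - {z}) u. ?f (S - {z, u, v}))"
        if "z \<in> S - {u}" for z
        using wpoly_rec[of "S - {z}" u E w] less.prems u that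
        by (auto simp: Diff_insert2[symmetric] simp del: mult_pCons_left)
      then show ?thesis by simp
    qed
    also have "\<dots> = (\<Sum>u\<in>S. ?f (S - {u}))"
      using u less.prems by (simp add: sum.remove)
    finally show ?thesis .
  qed simp
qed

text \<open>The recursion at a vertex of \<open>A\<close> meets neighbours in \<open>A\<close> only,
  so the factor of \<open>B\<close> is carried along. It makes multiplicities additive over
  components.\<close>

lemma wpoly_Un:
  assumes "finite A" "finite B" "A \<inter> B = {}"
    and "\<And>a b. a \<in> A \<Longrightarrow> b \<in> B \<Longrightarrow> {a, b} \<notin> E"
  shows "wpoly E w (A \<union> B) = wpoly E w A * wpoly E w B"
  using assms
proof (induction "card A" arbitrary: A rule: less_induct)
  case less
  show ?case
  proof (cases "A = {}")
    case False
    then obtain u where u: "u \<in> A" by auto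
    have IH: "wpoly E w (A \<union> B - X) = wpoly E w (A - X) * wpoly E w B" if "u \<in> X" "X \<subseteq> A" for X
    proof -
      have "A \<union> B - X = (A - X) \<union> B" using that less.prems by auto
      moreover have "card (A - X) < card A" using u less.prems that by (intro psubset_card_mono) auto
      moreover have "(A - X) \<inter> B = {}" using less.prems(3) by auto
      ultimately show ?thesis using less.hyps[of "A - X"] less.prems by simp
    qed
    have n: "nbrs E (A \<union> B) u = nbrs E A u" using less.prems(3,4) u by (auto simp: nbrs_def)
    have "wpoly E w (A \<union> B) = [:w u, 1:] * (wpoly E w (A - {u}) * wpoly E w B)
        - (\<Sum>v\<in>nbrs E A u. wpoly E w (A - {u, v}) * wpoly E w B)"
      using wpoly_rec[of "A \<union> B" u E w] less.prems u
      by (simp add: n IH del: mult_pCons_left) (auto intro!: sum.cong simp: IH nbrs_def)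
    then show ?thesis
      unfolding wpoly_rec[OF less.prems(1) u, of E w]
      by (simp add: left_diff_distrib sum_distrib_right mult.assoc del: mult_pCons_left)
  qed simp
qed

text \<open>Insert the recursion at \<open>u\<close> into the Wronskian of f and f_u. The derivative
  of the linear factor yields f_u^2, and each neighbour \<open>v\<close> adds the Wronskian of f_u
  and f_uv, which is nonnegative by induction.\<close>

lemma wpoly_Wronskian:
  "finite S \<Longrightarrow> u \<in> S \<Longrightarrow>
    (poly (wpoly E w (S - {u})) x)\<^sup>2 \<le> poly (pderiv (wpoly E w S) * wpoly E w (S - {u})
       - wpoly E w S * pderiv (wpoly E w (S - {u}))) x"
proof (induction "card S" arbitrary: S u rule: less_induct)
  case less
  let ?f = "wpoly E w" and ?g = "\<lambda>v. wpoly E w (S - {u, v})"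
  let ?t = "?f (S - {u})"
  have eq: "pderiv (?f S) * ?t - ?f S * pderiv ?t
     = ?t\<^sup>2 + (\<Sum>v\<in>nbrs E S u. pderiv ?t * ?g v - ?t * pderiv (?g v))"
    unfolding wpoly_rec[OF less.prems, of E w] sum_subtractf sum_distrib_left[symmetric]
      pderiv_diff pderiv_mult pderiv_sum
    by (simp add: pderiv_pCons algebra_simps power2_eq_square)
  have "0 \<le> poly (pderiv ?t * ?g v - ?t * pderiv (?g v)) x" if v: "v \<in> nbrs E S u" for v
  proof -
    have "card (S - {u}) < card S" using less.prems by (intro psubset_card_mono) auto
    from less.hyps[OF this, of v] v less.prems(1)
    have "0 \<le> (poly (?g v) x)\<^sup>2" "(poly (?g v) x)\<^sup>2 \<le> poly (pderiv ?t * ?g v - ?t * pderiv (?g v)) x"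
      by (auto simp: nbrs_def Diff_insert2[symmetric])
    then show ?thesis by linarith
  qed
  then show ?case
    unfolding eq by (simp add: poly_sum sum_nonneg)
qed

text \<open>Expand both f and f_d at \<open>u\<close>: the linear factors cancel, an edge from
  \<open>u\<close> to \<open>d\<close> leaves f_ud^2, and every other neighbour \<open>v\<close>
  leaves the same expression for \<open>v\<close> and \<open>d\<close> in \<open>S - {u}\<close>.
  The induction moves \<open>u\<close> along edges while \<open>d\<close> stays fixed.\<close>

lemma wpoly_Christoffel_Darboux:
  "finite S \<Longrightarrow> u \<in> S \<Longrightarrow> d \<in> S \<Longrightarrow> u \<noteq> d \<Longrightarrow>
    (if {u, d} \<in> E then (poly (wpoly E w (S - {u, d})) x)\<^sup>2 else 0) \<le>
    poly (wpoly E w (S - {u}) * wpoly E w (S - {d}) - wpoly E w S * wpoly E w (S - {u, d})) x"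
proof (induction "card S" arbitrary: S u rule: less_induct)
  case less
  let ?f = "wpoly E w"
  let ?N = "nbrs E (S - {d}) u"
  let ?c = "\<lambda>v. ?f (S - {u, v}) * ?f (S - {u, d}) - ?f (S - {u}) * ?f (S - {u, d, v})"
  have N: "nbrs E S u = (if {u, d} \<in> E then insert d ?N else ?N)" "d \<notin> ?N"
    using less.prems by (auto simp: nbrs_def)
  have rd: "?f (S - {d}) = [:w u, 1:] * ?f (S - {u, d}) - (\<Sum>v\<in>?N. ?f (S - {u, d, v}))"
    using wpoly_rec[of "S - {d}" u E w] less.prems
    by (auto simp: Diff_insert2[symmetric] insert_commute simp del: mult_pCons_left)
  have ru: "?f S = [:w u, 1:] * ?f (S - {u}) - (\<Sum>v\<in>?N. ?f (S - {u, v}))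
      - (if {u, d} \<in> E then ?f (S - {u, d}) else 0)"
    using wpoly_rec[OF less.prems(1,2), of E w] N less.prems(1) by (auto simp del: mult_pCons_left)
  have eq: "?f (S - {u}) * ?f (S - {d}) - ?f S * ?f (S - {u, d})
     = (if {u, d} \<in> E then (?f (S - {u, d}))\<^sup>2 else 0) + (\<Sum>v\<in>?N. ?c v)"
    unfolding rd ru sum_subtractf sum_distrib_left[symmetric] sum_distrib_right[symmetric]
    by (simp add: algebra_simps power2_eq_square)
  have "0 \<le> poly (?c v) x" if v: "v \<in> ?N" for v
  proof -
    have "card (S - {u}) < card S" using less.prems by (intro psubset_card_mono) auto
    from less.hyps[OF this, of v] v less.prems
    have "(if {v, d} \<in> E then (poly (?f (S - {u} - {v, d})) x)\<^sup>2 else 0) \<le> poly (?c v) x"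
      by (auto simp: nbrs_def Diff_insert2[symmetric] insert_commute)
    then show ?thesis by (smt (verit) zero_le_power2)
  qed
  then have "0 \<le> (\<Sum>v\<in>?N. poly (?c v) x)" by (rule sum_nonneg)
  then show ?case
    unfolding eq by (simp add: poly_sum)
qed

subsection \<open>Leading coefficients and interlacing\<close>

text \<open>\<open>p = c (x - \<theta>)^k + O((x - \<theta>)^(k + 1))\<close> near \<open>\<theta>\<close>; here \<open>c = 0\<close> is allowed.\<close>

definition leading :: "real \<Rightarrow> real poly \<Rightarrow> nat \<Rightarrow> real \<Rightarrow> bool" where
  "leading \<theta> p k c \<longleftrightarrow> (\<exists>q. p = [:-\<theta>, 1:] ^ k * q \<and> poly q \<theta> = c)"

lemma leading_add: "leading \<theta> p k c \<Longrightarrow> leading \<theta> q k d \<Longrightarrow> leading \<theta> (p + q) k (c + d)"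
  unfolding leading_def by (metis distrib_left poly_add)

lemma leading_diff: "leading \<theta> p k c \<Longrightarrow> leading \<theta> q k d \<Longrightarrow> leading \<theta> (p - q) k (c - d)"
  unfolding leading_def by (metis right_diff_distrib poly_diff)

lemma leading_smult: "leading \<theta> p k c \<Longrightarrow> leading \<theta> (smult a p) k (a * c)"
  unfolding leading_def by (metis mult_smult_right poly_smult)

lemma leading_mult: "leading \<theta> p k c \<Longrightarrow> leading \<theta> q l d \<Longrightarrow> leading \<theta> (p * q) (k + l) (c * d)"
  unfolding leading_def
  by (elim exE conjE, rule_tac x = "qa * qb" for qa qb in exI)
     (auto simp: power_add mult_ac)

lemma leading_weaken:
  assumes "leading \<theta> p l c" "k < l"
  shows "leading \<theta> p k 0"
proof -
  obtain q where q: "p = [:-\<theta>, 1:] ^ l * q" using assms(1) by (auto simp: leading_def)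
  have "[:-\<theta>, 1:] ^ l = [:-\<theta>, 1:] ^ k * [:-\<theta>, 1:] ^ (l - k)"
    using assms(2) by (simp flip: power_add)
  then have "p = [:-\<theta>, 1:] ^ k * ([:-\<theta>, 1:] ^ (l - k) * q)" using q by (simp only: mult.assoc)
  moreover have "poly ([:-\<theta>, 1:] ^ (l - k) * q) \<theta> = 0" using assms(2) by simp
  ultimately show ?thesis unfolding leading_def by blast
qed

lemma leading_cancel:
  assumes "leading \<theta> ([:-\<theta>, 1:] * p) (Suc k) c"
  shows "leading \<theta> p k c"
proof -
  obtain q where q: "[:-\<theta>, 1:] * p = [:-\<theta>, 1:] * ([:-\<theta>, 1:] ^ k * q)" "poly q \<theta> = c"
    using assms unfolding leading_def power_Suc mult.assoc by blast
  then have "p = [:-\<theta>, 1:] ^ k * q" by (simp only: mult_cancel_left) simp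
  then show ?thesis using q(2) by (auto simp: leading_def)
qed

lemma leading_imp_order:
  assumes "leading \<theta> p k c" "c \<noteq> 0"
  shows "order \<theta> p = k"
proof -
  obtain q where q: "p = [:-\<theta>, 1:] ^ k * q" "poly q \<theta> = c" using assms(1) by (auto simp: leading_def)
  then have "q \<noteq> 0" "order \<theta> q = 0" using assms(2) by (auto simp: order_root)
  then show ?thesis using q(1) by (simp add: order_mult order_power_n_n)
qed

lemma leading_order:
  assumes "p \<noteq> 0" "k \<le> order \<theta> p"
  obtains c where "leading \<theta> p k c" "c \<noteq> 0 \<longleftrightarrow> order \<theta> p = k"
proof -
  obtain q where q: "p = [:-\<theta>, 1:] ^ order \<theta> p * q" "poly q \<theta> \<noteq> 0"
    using order_decomp[OF assms(1), of \<theta>] by (auto simp: poly_eq_0_iff_dvd)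
  then have l: "leading \<theta> p (order \<theta> p) (poly q \<theta>)" by (auto simp: leading_def)
  show ?thesis
  proof (cases "order \<theta> p = k")
    case True
    then show ?thesis using that l q(2) by auto
  next
    case False
    then show ?thesis using that[of 0] leading_weaken[OF l] assms(2) by auto
  qed
qed

lemma leading_zero_order:
  assumes "leading \<theta> p k 0" "p \<noteq> 0"
  shows "k < order \<theta> p"
proof -
  obtain q where q: "p = [:-\<theta>, 1:] ^ k * q" "poly q \<theta> = 0" using assms(1) by (auto simp: leading_def)
  then have "q \<noteq> 0" using assms(2) by auto
  then have "order \<theta> q > 0" using q(2) by (simp add: order_root)
  moreover have "order \<theta> p = k + order \<theta> q"
    using q(1) assms(2) by (simp add: order_mult order_power_n_n)
  ultimately show ?thesis by simp
qed

text \<open>The factor x - \<theta> keeps the exponent at \<open>k\<close>, so no truncated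
  \<open>k - 1\<close> appears and \<open>k = 0\<close> is covered too.\<close>

lemma leading_pderiv:
  assumes "leading \<theta> p k c"
  shows "leading \<theta> ([:-\<theta>, 1:] * pderiv p) k (real k * c)"
proof -
  obtain q where q: "p = [:-\<theta>, 1:] ^ k * q" "poly q \<theta> = c" using assms by (auto simp: leading_def)
  have "[:-\<theta>, 1:] * pderiv p = [:-\<theta>, 1:] ^ k * (smult (real k) q + [:-\<theta>, 1:] * pderiv q)"
  proof (cases k)
    case (Suc j)
    have "pderiv p = [:-\<theta>, 1:] ^ Suc j * pderiv q + smult (real (Suc j)) ([:-\<theta>, 1:] ^ j * q)"
      unfolding q(1) Suc pderiv_mult pderiv_power_Suc by (simp add: pderiv_pCons mult.commute)
    then show ?thesis
      unfolding Suc by (simp only: power_Suc distrib_left mult_smult_right mult_smult_left mult_ac add_ac)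
  qed (simp add: q(1))
  then show ?thesis unfolding leading_def using q(2) by fastforce
qed

text \<open>Close to \<theta> the cofactor \<open>q\<close> has the sign of \<open>c\<close>. A
  sample point to the right of \<theta> then gives the sign of \<open>c\<close>, and one to the left
  the parity of \<open>k\<close>.\<close>

lemma leading_nonneg:
  assumes p: "leading \<theta> p k c" "c \<noteq> 0" and nn: "\<And>x. 0 \<le> poly p x"
  shows "even k" "c > 0"
proof -
  obtain q where q: "p = [:-\<theta>, 1:] ^ k * q" "poly q \<theta> = c" using p by (auto simp: leading_def)
  have ev: "\<forall>\<^sub>F x in at \<theta>. poly q x * c > 0"
  proof (rule order_tendstoD)
    show "((\<lambda>x. poly q x * c) \<longlongrightarrow> c * c) (at \<theta>)"
      unfolding q(2)[symmetric]
      by (intro tendsto_intros isContD[OF poly_isCont])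
    show "0 < c * c" using p(2) by (auto simp: zero_less_mult_iff)
  qed
  then obtain e where e: "e > 0" "\<And>x. x \<noteq> \<theta> \<Longrightarrow> dist x \<theta> < e \<Longrightarrow> poly q x * c > 0"
    by (auto simp: eventually_at)
  have val: "poly p x = (x - \<theta>) ^ k * poly q x" for x by (simp add: q(1))
  have r: "poly q (\<theta> + e / 2) * c > 0" "poly q (\<theta> - e / 2) * c > 0"
    using e by (auto simp: dist_real_def)
  have "(e / 2) ^ k > 0" using e(1) by simp
  moreover have "0 \<le> (e / 2) ^ k * poly q (\<theta> + e / 2)" using nn[of "\<theta> + e / 2"] by (simp add: val)
  ultimately have "poly q (\<theta> + e / 2) \<ge> 0" by (simp add: zero_le_mult_iff)
  then show c: "c > 0" using r(1) by (auto simp: zero_less_mult_iff)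
  then have "poly q (\<theta> - e / 2) > 0" using r(2) by (auto simp: zero_less_mult_iff)
  then have "0 \<le> (- (e / 2)) ^ k" using nn[of "\<theta> - e / 2"] by (simp add: val zero_le_mult_iff)
  then show "even k"
    using e(1) by (auto simp: zero_le_power_eq)
qed

text \<open>Both derivatives are first multiplied by x - \<theta>, which is divided out at the end.
  The coefficient is 0 for \<open>a = b\<close>, so information comes from unequal exponents
  only.\<close>

lemma leading_Wronskian:
  assumes "leading \<theta> p a c" "leading \<theta> q b d" "0 < a + b"
  shows "leading \<theta> (pderiv p * q - p * pderiv q) (a + b - 1) ((real a - real b) * (c * d))"
proof (rule leading_cancel)
  have "leading \<theta> (([:-\<theta>, 1:] * pderiv p) * q - p * ([:-\<theta>, 1:] * pderiv q)) (a + b)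
      (real a * c * d - c * (real b * d))"
    by (intro leading_diff leading_mult leading_pderiv assms)
  moreover have "([:-\<theta>, 1:] * pderiv p) * q - p * ([:-\<theta>, 1:] * pderiv q)
      = [:-\<theta>, 1:] * (pderiv p * q - p * pderiv q)"
    by (simp only: right_diff_distrib mult_ac)
  ultimately show "leading \<theta> ([:-\<theta>, 1:] * (pderiv p * q - p * pderiv q)) (Suc (a + b - 1))
      ((real a - real b) * (c * d))"
    using assms(3) by (simp only: Suc_diff_1 left_diff_distrib right_diff_distrib mult_ac)
qed

section \<open>Multiplicities, interlacing and the sign rule\<close>

definition wmult :: "real \<Rightarrow> 'a set set \<Rightarrow> ('a \<Rightarrow> real) \<Rightarrow> 'a set \<Rightarrow> nat" where
  "wmult \<theta> E w S = order \<theta> (wpoly E w S)"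

text \<open>An exponent below the multiplicity returns the coefficient 0. Thus several polynomials
  can be expanded to one common exponent before they are combined.\<close>

lemma wpoly_leading:
  assumes "finite S" "k \<le> wmult \<theta> E w S"
  obtains c where "leading \<theta> (wpoly E w S) k c" "c \<noteq> 0 \<longleftrightarrow> wmult \<theta> E w S = k"
  using leading_order[OF wpoly_nonzero[OF assms(1)]] assms(2) unfolding wmult_def by metis

lemma wmult_eqI: "leading \<theta> (wpoly E w S) k c \<Longrightarrow> c \<noteq> 0 \<Longrightarrow> wmult \<theta> E w S = k"
  unfolding wmult_def by (rule leading_imp_order)

lemma wmult_less: "leading \<theta> (wpoly E w S) k 0 \<Longrightarrow> finite S \<Longrightarrow> k < wmult \<theta> E w S"
  unfolding wmult_def by (rule leading_zero_order[OF _ wpoly_nonzero])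

text \<open>Let f and f_u have orders \<open>a\<close> and \<open>b\<close> with \<open>a\<close> at
  least \<open>b + 2\<close>. Then the Wronskian vanishes to an order above \<open>2 b\<close>,
  although it dominates f_u^2, whose order is exactly \<open>2 b\<close>.\<close>

lemma wmult_le_Suc:
  assumes fin: "finite S" and u: "u \<in> S"
  shows "wmult \<theta> E w S \<le> Suc (wmult \<theta> E w (S - {u}))"
proof (rule ccontr)
  define a b where "a = wmult \<theta> E w S" and "b = wmult \<theta> E w (S - {u})"
  let ?W = "pderiv (wpoly E w S) * wpoly E w (S - {u}) - wpoly E w S * pderiv (wpoly E w (S - {u}))"
  assume "\<not> ?thesis"
  then have ab: "b + 2 \<le> a" by (simp add: a_def b_def)
  obtain c where c: "leading \<theta> (wpoly E w S) a c"
    by (rule wpoly_leading[OF fin, of a \<theta> E w]) (auto simp: a_def)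
  obtain d where d: "leading \<theta> (wpoly E w (S - {u})) b d" "d \<noteq> 0"
    by (rule wpoly_leading[of "S - {u}" b \<theta> E w]) (auto simp: b_def fin)
  have "leading \<theta> ?W (b + b) 0"
    by (rule leading_weaken[OF leading_Wronskian[OF c d(1)]]) (use ab in auto)
  then have "leading \<theta> (?W - wpoly E w (S - {u}) * wpoly E w (S - {u})) (b + b) (0 - d * d)"
    by (intro leading_diff leading_mult d)
  moreover have "0 \<le> poly (?W - wpoly E w (S - {u}) * wpoly E w (S - {u})) x" for x
    using wpoly_Wronskian[OF assms, of E w x] by (simp add: power2_eq_square)
  ultimately have "0 - d * d > 0" using d(2) by (intro leading_nonneg(2)) auto
  then show False using zero_le_square[of d] by linarith
qed

text \<open>The other half of interlacing follows from the first one: applied to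
  \<open>S - {u}\<close>, it shows that a power of x - \<theta> divides f_u and every f_uv, and the
  recursion passes that power on to f.\<close>

lemma wmult_delete_le_Suc:
  assumes fin: "finite S" and u: "u \<in> S"
  shows "wmult \<theta> E w (S - {u}) \<le> Suc (wmult \<theta> E w S)"
proof -
  \<comment> \<open>Truncated subtraction is harmless: if f_u does not vanish at \<theta>, the power
    is 1.\<close>
  define b where "b = wmult \<theta> E w (S - {u}) - 1"
  have "[:-\<theta>, 1:] ^ b dvd wpoly E w (S - {u, v})" if "v \<in> nbrs E S u" for v
    using wmult_le_Suc[of "S - {u}" v \<theta> E w] that fin
    by (auto simp: b_def wmult_def nbrs_def order_divides Diff_insert2[symmetric])
  moreover have "[:-\<theta>, 1:] ^ b dvd wpoly E w (S - {u})"
    by (auto simp: b_def wmult_def order_divides)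
  ultimately have "[:-\<theta>, 1:] ^ b dvd wpoly E w S"
    unfolding wpoly_rec[OF assms, of E w] by (intro dvd_diff dvd_mult dvd_sum)
  then show ?thesis
    using wpoly_nonzero[OF fin, of E w] by (simp add: order_divides wmult_def b_def)
qed

text \<open>This is the sign of the leading coefficient of the nonnegative Wronskian. Hence
  \<open>c\<close> and \<open>d\<close> have opposite signs if deleting \<open>u\<close> raises the
  multiplicity, and equal signs if it lowers it.\<close>

lemma leading_sign:
  assumes fin: "finite S" and u: "u \<in> S"
    and "leading \<theta> (wpoly E w S) a c" "c \<noteq> 0" "leading \<theta> (wpoly E w (S - {u})) b d" "d \<noteq> 0" "a \<noteq> b"
  shows "(real a - real b) * (c * d) > 0"
proof (rule leading_nonneg(2)[OF leading_Wronskian[OF assms(3,5)]])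
  show "0 \<le> poly (pderiv (wpoly E w S) * wpoly E w (S - {u})
      - wpoly E w S * pderiv (wpoly E w (S - {u}))) x" for x
    by (rule order_trans[OF zero_le_power2 wpoly_Wronskian[OF assms(1,2)]])
qed (use assms in auto)

subsection \<open>Essential and positive vertices\<close>

lemma Diff_Diff_singleton: "S - X - {u} = S - insert u X"
  by auto

lemma wmult_Diff_le_Suc:
  "finite S \<Longrightarrow> u \<in> S - X \<Longrightarrow> wmult \<theta> E w (S - X) \<le> Suc (wmult \<theta> E w (S - insert u X))"
  using wmult_le_Suc[of "S - X" u \<theta> E w] by (simp add: Diff_Diff_singleton)

lemma wmult_Diff_insert_le_Suc:
  "finite S \<Longrightarrow> u \<in> S - X \<Longrightarrow> wmult \<theta> E w (S - insert u X) \<le> Suc (wmult \<theta> E w (S - X))"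
  using wmult_delete_le_Suc[of "S - X" u \<theta> E w] by (simp add: Diff_Diff_singleton)

lemma wmult_le_Diff:
  assumes "finite S" "finite Y" "X \<subseteq> Y" "Y \<subseteq> S"
  shows "wmult \<theta> E w (S - Y) \<le> wmult \<theta> E w (S - X) + card (Y - X)"
  using assms(3,4) \<open>finite Y\<close>
proof (induction "card (Y - X)" arbitrary: Y)
  case 0
  then have "Y = X" by auto
  then show ?case by simp
next
  case (Suc n)
  then have "Y - X \<noteq> {}" by auto
  then obtain u where u: "u \<in> Y" "u \<notin> X" by auto
  have eq: "Y - X = insert u (Y - {u} - X)" using u by auto
  have c: "card (Y - X) = Suc (card (Y - {u} - X))"
    unfolding eq using Suc.prems(3) by (subst card_insert_disjoint) auto
  have "wmult \<theta> E w (S - (Y - {u})) \<le> wmult \<theta> E w (S - X) + card (Y - {u} - X)"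
    using Suc.hyps(1)[of "Y - {u}"] Suc.hyps(2) Suc.prems u c by auto
  moreover have "wmult \<theta> E w (S - insert u (Y - {u})) \<le> Suc (wmult \<theta> E w (S - (Y - {u})))"
    using u Suc.prems assms(1) by (intro wmult_Diff_insert_le_Suc) auto
  moreover have "insert u (Y - {u}) = Y" using u by auto
  ultimately show ?case using c by simp
qed

section \<open>Parity and edge constraints from the second inequality\<close>

lemma Christoffel_Darboux_leading:
  assumes "finite S" "u \<in> S" "d \<in> S" "u \<noteq> d"
    and "leading \<theta> (wpoly E w (S - {u}) * wpoly E w (S - {d}) - wpoly E w S * wpoly E w (S - {u, d})) k c"
    and "c \<noteq> 0"
  shows "even k"
proof (rule leading_nonneg(1)[OF assms(5,6)])
  fix x
  show "0 \<le> poly (wpoly E w (S - {u}) * wpoly E w (S - {d}) - wpoly E w S * wpoly E w (S - {u, d})) x"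
    by (rule order_trans[OF _ wpoly_Christoffel_Darboux[OF assms(1-4)]]) auto
qed

text \<open>Along an edge the expression dominates f_ud^2. If it vanishes beyond exponent
  \<open>2 * k\<close>, subtracting f_ud^2 leaves the coefficient -c^2 there, which must not be
  negative.\<close>

lemma Christoffel_Darboux_edge_leading:
  assumes "finite S" "u \<in> S" "d \<in> S" "u \<noteq> d" "{u, d} \<in> E"
    and "leading \<theta> (wpoly E w (S - {u}) * wpoly E w (S - {d}) - wpoly E w S * wpoly E w (S - {u, d}))
       (2 * k) 0"
    and "leading \<theta> (wpoly E w (S - {u, d})) k c"
  shows "c = 0"
proof (rule ccontr)
  assume "c \<noteq> 0"
  let ?C = "wpoly E w (S - {u}) * wpoly E w (S - {d}) - wpoly E w S * wpoly E w (S - {u, d})"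
  have "leading \<theta> (?C - wpoly E w (S - {u, d}) * wpoly E w (S - {u, d})) (2 * k) (0 - c * c)"
    unfolding mult_2 by (intro leading_diff leading_mult assms) (use assms(6) in \<open>simp add: mult_2\<close>)
  moreover have "0 \<le> poly (?C - wpoly E w (S - {u, d}) * wpoly E w (S - {u, d})) x" for x
    using wpoly_Christoffel_Darboux[OF assms(1-4), of E w x] assms(5) by (simp add: power2_eq_square)
  ultimately have "0 - c * c > 0" using \<open>c \<noteq> 0\<close> by (intro leading_nonneg(2)) auto
  then show False using zero_le_square[of c] by linarith
qed

text \<open>If deleting \<open>u\<close> kept the multiplicity \<open>Suc k\<close>, the edge
  constraint would force \<open>e = 0\<close>, and f_u f_d - f f_ud would have the nonzero
  coefficient \<open>cu * cd\<close> at the odd exponent \<open>2 k + 1\<close>.\<close>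

lemma special_imp_positive:
  assumes S: "finite S" "u \<in> S" "d \<in> S" "u \<noteq> d" "{u, d} \<in> E"
    and d: "wmult \<theta> E w S = Suc (wmult \<theta> E w (S - {d}))"
    and u: "wmult \<theta> E w S \<noteq> Suc (wmult \<theta> E w (S - {u}))"
  shows "wmult \<theta> E w (S - {u}) = Suc (wmult \<theta> E w S)"
proof (rule ccontr)
  assume nt: "\<not> ?thesis"
  define k where "k = wmult \<theta> E w (S - {d})"
  have mS: "wmult \<theta> E w S = Suc k" and mu: "wmult \<theta> E w (S - {u}) = Suc k"
    using nt d u wmult_le_Suc[OF S(1,2), of \<theta> E w] wmult_delete_le_Suc[OF S(1,2), of \<theta> E w]
    by (auto simp: k_def)
  have mud: "k \<le> wmult \<theta> E w (S - {u, d})"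
    using wmult_Diff_le_Suc[of S d "{u}" \<theta> E w] S mu by (simp add: insert_commute)
  obtain c where c: "leading \<theta> (wpoly E w S) (Suc k) c"
    by (rule wpoly_leading[OF S(1), of "Suc k" \<theta> E w]) (auto simp: mS)
  obtain cu where cu: "leading \<theta> (wpoly E w (S - {u})) (Suc k) cu" "cu \<noteq> 0"
    by (rule wpoly_leading[of "S - {u}" "Suc k" \<theta> E w]) (auto simp: mu S)
  obtain cd where cd: "leading \<theta> (wpoly E w (S - {d})) k cd" "cd \<noteq> 0"
    by (rule wpoly_leading[of "S - {d}" k \<theta> E w]) (auto simp: k_def S)
  obtain e where e: "leading \<theta> (wpoly E w (S - {u, d})) k e"
    by (rule wpoly_leading[of "S - {u, d}" k \<theta> E w]) (use mud S in auto)
  let ?C = "wpoly E w (S - {u}) * wpoly E w (S - {d}) - wpoly E w S * wpoly E w (S - {u, d})"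
  have C: "leading \<theta> ?C (Suc k + k) (cu * cd - c * e)"
    by (intro leading_diff leading_mult c cu cd e)
  then have "leading \<theta> ?C (2 * k) 0" by (rule leading_weaken) simp
  then have "e = 0" by (rule Christoffel_Darboux_edge_leading[OF S _ e])
  then have "even (Suc k + k)"
    using cu cd by (intro Christoffel_Darboux_leading[OF S(1-4) C]) auto
  then show False by simp
qed

text \<open>Both f_u f_d and f f_ud vanish to order \<open>2 j + 2\<close> at least, so the edge
  constraint removes the coefficient of f_ud at exponent \<open>j\<close>. In other words,
  \<open>d\<close> is no longer essential once \<open>u\<close> is deleted;
  \<open>critical_mult\<close> uses this along each edge of a walk.\<close>

lemma adjacent_essential:
  assumes S: "finite S" "u \<in> S" "d \<in> S" "u \<noteq> d" "{u, d} \<in> E"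
    and m: "wmult \<theta> E w S = Suc (Suc j)" "wmult \<theta> E w (S - {u}) = Suc j" "wmult \<theta> E w (S - {d}) = Suc j"
  shows "Suc j \<le> wmult \<theta> E w (S - {u, d})"
proof -
  have mud: "j \<le> wmult \<theta> E w (S - {u, d})"
    using wmult_Diff_le_Suc[of S d "{u}" \<theta> E w] S m by (simp add: insert_commute)
  obtain c where c: "leading \<theta> (wpoly E w S) (Suc (Suc j)) c"
    by (rule wpoly_leading[OF S(1), of "Suc (Suc j)" \<theta> E w]) (auto simp: m)
  obtain cu where cu: "leading \<theta> (wpoly E w (S - {u})) (Suc j) cu"
    by (rule wpoly_leading[of "S - {u}" "Suc j" \<theta> E w]) (auto simp: m S)
  obtain cd where cd: "leading \<theta> (wpoly E w (S - {d})) (Suc j) cd"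
    by (rule wpoly_leading[of "S - {d}" "Suc j" \<theta> E w]) (auto simp: m S)
  obtain e where e: "leading \<theta> (wpoly E w (S - {u, d})) j e" "e \<noteq> 0 \<longleftrightarrow> wmult \<theta> E w (S - {u, d}) = j"
    by (rule wpoly_leading[of "S - {u, d}" j \<theta> E w]) (use mud S in auto)
  let ?C = "wpoly E w (S - {u}) * wpoly E w (S - {d}) - wpoly E w S * wpoly E w (S - {u, d})"
  have "leading \<theta> (wpoly E w S * wpoly E w (S - {u, d})) (Suc j + Suc j) (c * e)"
    using leading_mult[OF c e(1)] by simp
  then have "leading \<theta> ?C (Suc j + Suc j) (cu * cd - c * e)"
    by (intro leading_diff leading_mult[OF cu cd])
  then have "leading \<theta> ?C (2 * j) 0" by (rule leading_weaken) simp
  then have "e = 0" by (rule Christoffel_Darboux_edge_leading[OF S _ e(1)])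
  then show ?thesis using e(2) mud by simp
qed

text \<open>If the claim failed, a generic loop weight at \<open>v\<close> would lower the multiplicity of \<open>S\<close> by one,
  keep that of \<open>S - {u, z}\<close> and not lower the others, which makes the order of \<open>f\<^sub>u f\<^sub>z - f f\<^sub>u\<^sub>z \<ge> 0\<close> odd.\<close>

lemma essential_pair_trans:
  assumes S: "finite S" "u \<in> S" "v \<in> S" "z \<in> S" "u \<noteq> v" "v \<noteq> z" "u \<noteq> z"
    and m: "wmult \<theta> E w S = Suc (Suc j)" "wmult \<theta> E w (S - {u}) = Suc j"
      "wmult \<theta> E w (S - {v}) = Suc j" "wmult \<theta> E w (S - {z}) = Suc j"
    and uv: "Suc j \<le> wmult \<theta> E w (S - {u, v})" and vz: "Suc j \<le> wmult \<theta> E w (S - {v, z})"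
  shows "Suc j \<le> wmult \<theta> E w (S - {u, z})"
proof (rule ccontr)
  assume "\<not> ?thesis"
  then have muz: "wmult \<theta> E w (S - {u, z}) = j"
    using wmult_Diff_le_Suc[of S z "{u}" \<theta> E w] S m by (simp add: insert_commute)
  have muvz: "j \<le> wmult \<theta> E w (S - {u, v, z})"
    using wmult_Diff_le_Suc[of S z "{u, v}" \<theta> E w] S uv by (simp add: insert_commute)
  obtain c where c: "leading \<theta> (wpoly E w S) (Suc j) c" "c = 0"
    by (rule wpoly_leading[OF S(1), of "Suc j" \<theta> E w]) (auto simp: m)
  obtain cu where cu: "leading \<theta> (wpoly E w (S - {u})) (Suc j) cu"
    by (rule wpoly_leading[of "S - {u}" "Suc j" \<theta> E w]) (auto simp: m S)
  obtain cv where cv: "leading \<theta> (wpoly E w (S - {v})) (Suc j) cv" "cv \<noteq> 0"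
    by (rule wpoly_leading[of "S - {v}" "Suc j" \<theta> E w]) (auto simp: m S)
  obtain cz where cz: "leading \<theta> (wpoly E w (S - {z})) (Suc j) cz"
    by (rule wpoly_leading[of "S - {z}" "Suc j" \<theta> E w]) (auto simp: m S)
  obtain cuv where cuv: "leading \<theta> (wpoly E w (S - {u, v})) (Suc j) cuv"
    by (rule wpoly_leading[of "S - {u, v}" "Suc j" \<theta> E w]) (use uv S in auto)
  obtain cvz where cvz: "leading \<theta> (wpoly E w (S - {v, z})) (Suc j) cvz"
    by (rule wpoly_leading[of "S - {v, z}" "Suc j" \<theta> E w]) (use vz S in auto)
  obtain cuz where cuz: "leading \<theta> (wpoly E w (S - {u, z})) j cuz" "cuz \<noteq> 0"
    by (rule wpoly_leading[of "S - {u, z}" j \<theta> E w]) (use muz S in auto)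
  obtain e where e: "leading \<theta> (wpoly E w (S - {u, v, z})) j e"
    by (rule wpoly_leading[of "S - {u, v, z}" j \<theta> E w]) (use muvz S in auto)
  \<comment> \<open>The weight must be nonzero and must not make \<open>cuz + a * e\<close> vanish.
    As \<open>cuz\<close> is nonzero, 1 and 2 cannot both fail.\<close>
  define a :: real where "a = (if cuz + e = 0 then 2 else 1)"
  have a: "a \<noteq> 0" "cuz + a * e \<noteq> 0" using cuz(2) by (auto simp: a_def)
  define w' where "w' = w(v := w v + a)"
  have upd: "wpoly E w' T = wpoly E w T + smult a (wpoly E w (T - {v}))" if "v \<in> T" "finite T" for T
    unfolding w'_def using that by (intro wpoly_upd)
  have sets: "S - {u} - {v} = S - {u, v}" "S - {z} - {v} = S - {v, z}"
    "S - {u, z} - {v} = S - {u, v, z}" by auto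
  have F: "leading \<theta> (wpoly E w' S) (Suc j) (c + a * cv)"
    using S by (simp only: upd) (intro leading_add leading_smult c(1) cv)
  have Fu: "leading \<theta> (wpoly E w' (S - {u})) (Suc j) (cu + a * cuv)"
    using S by (subst upd) (auto simp: sets intro!: leading_add leading_smult cu cuv)
  have Fz: "leading \<theta> (wpoly E w' (S - {z})) (Suc j) (cz + a * cvz)"
    using S by (subst upd) (auto simp: sets intro!: leading_add leading_smult cz cvz)
  have Fuz: "leading \<theta> (wpoly E w' (S - {u, z})) j (cuz + a * e)"
    using S by (subst upd) (auto simp: sets intro!: leading_add leading_smult cuz(1) e)
  \<comment> \<open>The product of f_u and f_z vanishes to order \<open>2 j + 2\<close>, so at the
    odd exponent \<open>2 j + 1\<close> only the product of f and f_uz survives.\<close>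
  have "leading \<theta> (wpoly E w' (S - {u}) * wpoly E w' (S - {z})) (Suc j + j) 0"
    by (rule leading_weaken[OF leading_mult[OF Fu Fz]]) simp
  then have "leading \<theta> (wpoly E w' (S - {u}) * wpoly E w' (S - {z}) - wpoly E w' S * wpoly E w' (S - {u, z}))
      (Suc j + j) (0 - (c + a * cv) * (cuz + a * e))"
    by (intro leading_diff leading_mult F Fuz)
  then have "even (Suc j + j)"
    by (rule Christoffel_Darboux_leading[OF S(1,2,4,7)]) (use a c(2) cv(2) in auto)
  then show False by simp
qed

text \<open>Multiplicity \<open>m + 2\<close> for \<open>S - {u, v, z}\<close> is excluded by a loop at \<open>v\<close> that cancels the leading
  coefficient of \<open>S - {u, z}\<close>, and \<open>m + 1\<close> by equal loops at \<open>u\<close> and \<open>v\<close> that cancel the one of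
  \<open>S - {z}\<close>. In both cases interlacing breaks. The second weight is a square root, which is real because of
  the sign rule.\<close>

lemma positive_triple:
  assumes S: "finite S" "u \<in> S" "v \<in> S" "z \<in> S" "u \<noteq> v" "v \<noteq> z" "u \<noteq> z"
    and uv: "wmult \<theta> E w (S - {u, v}) = wmult \<theta> E w S + 2"
    and uz: "wmult \<theta> E w (S - {u, z}) = wmult \<theta> E w S + 2"
    and vz: "wmult \<theta> E w (S - {v, z}) = wmult \<theta> E w S + 2"
  shows "wmult \<theta> E w (S - {u, v, z}) = wmult \<theta> E w S + 3"
proof -
  define m where "m = wmult \<theta> E w S"
  note defs = m_def[symmetric]
  have mu: "wmult \<theta> E w (S - {u}) = Suc m" and mv: "wmult \<theta> E w (S - {v}) = Suc m"
    and mz: "wmult \<theta> E w (S - {z}) = Suc m"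
    using wmult_Diff_insert_le_Suc[of S u "{}" \<theta> E w] wmult_Diff_insert_le_Suc[of S v "{}" \<theta> E w]
      wmult_Diff_insert_le_Suc[of S z "{}" \<theta> E w] wmult_Diff_insert_le_Suc[of S v "{u}" \<theta> E w]
      wmult_Diff_insert_le_Suc[of S u "{v}" \<theta> E w] wmult_Diff_insert_le_Suc[of S u "{z}" \<theta> E w]
      S uv uz by (auto simp: defs insert_commute)
  have "wmult \<theta> E w (S - {u, v, z}) \<le> m + 3" and ge: "Suc m \<le> wmult \<theta> E w (S - {u, v, z})"
    using wmult_Diff_insert_le_Suc[of S z "{u, v}" \<theta> E w] wmult_Diff_le_Suc[of S z "{u, v}" \<theta> E w]
      S uv by (auto simp: defs insert_commute)
  moreover have "wmult \<theta> E w (S - {u, v, z}) \<noteq> m + 2"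
  proof
    assume uvz: "wmult \<theta> E w (S - {u, v, z}) = m + 2"
    obtain c where c: "leading \<theta> (wpoly E w (S - {u})) (m + 1) c" "c \<noteq> 0"
      by (rule wpoly_leading[of "S - {u}" "m + 1" \<theta> E w]) (use mu S in auto)
    obtain cv where cv: "leading \<theta> (wpoly E w (S - {u, v})) (m + 1) cv" "cv = 0"
      by (rule wpoly_leading[of "S - {u, v}" "m + 1" \<theta> E w]) (use uv S in \<open>auto simp: defs\<close>)
    obtain cz where cz: "leading \<theta> (wpoly E w (S - {u, z})) (m + 2) cz"
      by (rule wpoly_leading[of "S - {u, z}" "m + 2" \<theta> E w]) (use uz S in \<open>auto simp: defs\<close>)
    obtain e where e: "leading \<theta> (wpoly E w (S - {u, v, z})) (m + 2) e" "e \<noteq> 0"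
      by (rule wpoly_leading[of "S - {u, v, z}" "m + 2" \<theta> E w]) (use uvz S in auto)
    \<comment> \<open>The weight is chosen so that \<open>cz\<close> is cancelled by the multiple of
      \<open>e\<close> that it adds.\<close>
    define w' where "w' = w(v := w v + - cz / e)"
    have upd: "wpoly E w' T = wpoly E w T + smult (- cz / e) (wpoly E w (T - {v}))"
      if "v \<in> T" "finite T" for T
      unfolding w'_def using that by (intro wpoly_upd)
    have sets: "S - {u} - {v} = S - {u, v}" "S - {u, z} - {v} = S - {u, v, z}" by auto
    \<comment> \<open>The change in f_u is a multiple of f_uv, whose order \<open>m + 2\<close> is
      too high to disturb exponent \<open>m + 1\<close>.\<close>
    have "leading \<theta> (wpoly E w' (S - {u})) (m + 1) (c + - cz / e * cv)"
      using S by (subst upd) (auto simp only: sets intro!: leading_add leading_smult c(1) cv(1))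
    then have 1: "wmult \<theta> E w' (S - {u}) = m + 1" by (rule wmult_eqI) (use c cv in auto)
    have "leading \<theta> (wpoly E w' (S - {u, z})) (m + 2) (cz + - cz / e * e)"
      using S by (subst upd) (auto simp only: sets intro!: leading_add leading_smult cz e(1))
    then have "m + 2 < wmult \<theta> E w' (S - {u, z})" using e(2) S by (intro wmult_less) auto
    then show False
      using 1 wmult_Diff_insert_le_Suc[of S z "{u}" \<theta> E w'] S by (simp add: insert_commute)
  qed
  moreover have "wmult \<theta> E w (S - {u, v, z}) \<noteq> m + 1"
  proof
    assume uvz: "wmult \<theta> E w (S - {u, v, z}) = m + 1"
    obtain c where c: "leading \<theta> (wpoly E w S) m c" "c \<noteq> 0"
      by (rule wpoly_leading[of S m \<theta> E w]) (use S in \<open>auto simp: defs\<close>)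
    obtain cv where cv: "leading \<theta> (wpoly E w (S - {v})) (m + 1) cv" "cv \<noteq> 0"
      by (rule wpoly_leading[of "S - {v}" "m + 1" \<theta> E w]) (use mv S in auto)
    obtain cz where cz: "leading \<theta> (wpoly E w (S - {z})) (m + 1) cz" "cz \<noteq> 0"
      by (rule wpoly_leading[of "S - {z}" "m + 1" \<theta> E w]) (use mz S in auto)
    obtain cvz where cvz: "leading \<theta> (wpoly E w (S - {v, z})) (m + 2) cvz" "cvz \<noteq> 0"
      by (rule wpoly_leading[of "S - {v, z}" "m + 2" \<theta> E w]) (use vz S in \<open>auto simp: defs\<close>)
    obtain e where e: "leading \<theta> (wpoly E w (S - {u, v, z})) (m + 1) e" "e \<noteq> 0"
      by (rule wpoly_leading[of "S - {u, v, z}" "m + 1" \<theta> E w]) (use uvz S in auto)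
    \<comment> \<open>Deleting \<open>v\<close> and then \<open>z\<close> raises the multiplicity
      each time and flips the sign twice; deleting \<open>u\<close> after that lowers it and keeps
      the sign. So \<open>e\<close> has the sign of \<open>c\<close>, while \<open>cz\<close> has
      the opposite one.\<close>
    have "c * cv < 0" using leading_sign[OF S(1,3) c cv] by simp
    moreover have "c * cz < 0" using leading_sign[OF S(1,4) c cz] by simp
    moreover have "cv * cvz < 0"
      using leading_sign[of "S - {v}" z \<theta> E w _ cv _ cvz, unfolded Diff_Diff_singleton] S cv cvz
      by (fastforce simp: insert_commute)
    moreover have "cvz * e > 0"
      using leading_sign[of "S - {v, z}" u \<theta> E w _ cvz _ e, unfolded Diff_Diff_singleton] S cvz e
      by fastforce
    ultimately have sgn: "cz * e < 0" by (auto simp: mult_less_0_iff zero_less_mult_iff)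
    \<comment> \<open>Equal weights \<open>a\<close> at \<open>u\<close> and \<open>v\<close> add to
      f_z the terms a f_uz, a f_vz and a^2 f_uvz. The first two have order \<open>m + 2\<close>, so
      cancellation at exponent \<open>m + 1\<close> asks for
      \<open>a * a = - cz / e\<close>.\<close>
    define a where "a = sqrt (- cz / e)"
    have a: "a * a = - cz / e"
      using sgn by (auto simp: a_def mult_less_0_iff zero_le_divide_iff)
    define w' where "w' = (w(u := w u + a))(v := w v + a)"
    have upd: "wpoly E w' T = wpoly E w T + smult a (wpoly E w (T - {u}))
        + smult a (wpoly E w (T - {v})) + smult (a * a) (wpoly E w (T - {u, v}))"
      if T: "u \<in> T" "v \<in> T" "finite T" for T
    proof -
      have "w' = (w(u := w u + a))(v := (w(u := w u + a)) v + a)" using S by (simp add: w'_def)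
      then have "wpoly E w' T = wpoly E (w(u := w u + a)) T + smult a (wpoly E (w(u := w u + a)) (T - {v}))"
        using wpoly_upd[OF T(3,2)] by metis
      moreover have "T - {v} - {u} = T - {u, v}" by auto
      ultimately show ?thesis using wpoly_upd[OF T(3,1)] wpoly_upd[of "T - {v}" u E w a] T S
        by (simp add: smult_add_right)
    qed
    have sets: "S - {z} - {u} = S - {u, z}" "S - {z} - {v} = S - {v, z}"
      "S - {z} - {u, v} = S - {u, v, z}" by auto
    have low: "leading \<theta> (wpoly E w (S - X)) k 0" if k: "k < wmult \<theta> E w (S - X)" for k X
    proof -
      obtain c where "leading \<theta> (wpoly E w (S - X)) k c" "c \<noteq> 0 \<longleftrightarrow> wmult \<theta> E w (S - X) = k"
        by (rule wpoly_leading[of "S - X" k \<theta> E w]) (use k S in auto)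
      then show ?thesis using k by auto
    qed
    have "leading \<theta> (wpoly E w' S) m (c + a * 0 + a * 0 + (a * a) * 0)"
      unfolding upd[OF S(2,3,1)] using mu mv uv
      by (intro leading_add leading_smult c(1) low) (auto simp: defs)
    then have 1: "wmult \<theta> E w' S = m" by (rule wmult_eqI) (use c in auto)
    have "leading \<theta> (wpoly E w' (S - {z})) (m + 1) (cz + a * 0 + a * 0 + (a * a) * e)"
      using S by (subst upd) (auto simp only: sets uz vz defs intro!: leading_add leading_smult cz(1) e(1) low)
    then have "m + 1 < wmult \<theta> E w' (S - {z})" using e(2) S by (intro wmult_less) (auto simp: a)
    then show False
      using 1 wmult_delete_le_Suc[OF S(1,4), of \<theta> E w'] by simp
  qed
  ultimately show ?thesis unfolding defs by linarith
qed

text \<open>Delete one \<open>u\<close> of \<open>X\<close>. By \<open>positive_triple\<close> any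
  two further vertices still raise the multiplicity by 2, now starting from \<open>S - {u}\<close>,
  so the hypothesis on pairs is inherited.\<close>

lemma wmult_Diff_of_pairs:
  assumes "finite S" "X \<subseteq> S" "card X \<ge> 2"
    and "\<And>u v. u \<in> X \<Longrightarrow> v \<in> X \<Longrightarrow> u \<noteq> v \<Longrightarrow> wmult \<theta> E w (S - {u, v}) = wmult \<theta> E w S + 2"
  shows "wmult \<theta> E w (S - X) = wmult \<theta> E w S + card X"
  using assms(3,1,2,4)
proof (induction "card X" arbitrary: X S rule: nat_induct_at_least)
  case base
  then obtain u v where "X = {u, v}" "u \<noteq> v" by (metis card_2_iff)
  then show ?case using base by simp
next
  case (Suc n)
  then have finX: "finite X" by (auto intro: finite_subset)
  have "card X \<noteq> 0" using Suc.hyps(3) by linarith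
  then obtain u where u: "u \<in> X" by (metis card.empty equals0I)
  have c: "card (X - {u}) = n" using Suc.hyps(3) u finX by simp
  then have "card (X - {u}) \<noteq> 0" using Suc.hyps(1) by linarith
  then obtain v where v: "v \<in> X - {u}" by (metis card.empty equals0I)
  have mu: "wmult \<theta> E w (S - {u}) = wmult \<theta> E w S + 1"
    using Suc.prems(3)[of u v] u v Suc.prems(1) wmult_Diff_insert_le_Suc[of S u "{}" \<theta> E w]
      wmult_Diff_insert_le_Suc[of S v "{u}" \<theta> E w] subsetD[OF Suc.prems(2), of u]
      subsetD[OF Suc.prems(2), of v] by (auto simp: insert_commute)
  have "wmult \<theta> E w (S - {u} - (X - {u})) = wmult \<theta> E w (S - {u}) + card (X - {u})"
  proof (rule Suc.hyps(2))
    fix v z assume vz: "v \<in> X - {u}" "z \<in> X - {u}" "v \<noteq> z"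
    have "wmult \<theta> E w (S - {u, v, z}) = wmult \<theta> E w S + 3"
      using vz u Suc.prems by (intro positive_triple) auto
    moreover have "S - {u} - {v, z} = S - {u, v, z}" by auto
    ultimately show "wmult \<theta> E w (S - {u} - {v, z}) = wmult \<theta> E w (S - {u}) + 2"
      using mu by simp
  qed (use c[symmetric] Suc.prems(1,2) in auto)
  moreover have "S - {u} - (X - {u}) = S - X" using u by auto
  ultimately show ?case using mu c Suc.hyps(3) by simp
qed

text \<open>Otherwise interlacing makes every f_u vanish to the full order of f, and so does their
  sum, the derivative of f. But differentiation lowers the order of a root by one.\<close>

lemma exists_essential:
  assumes fin: "finite S" and pos: "wmult \<theta> E w S > 0"
  shows "\<exists>u\<in>S. wmult \<theta> E w S = Suc (wmult \<theta> E w (S - {u}))"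
proof (rule ccontr)
  assume neg: "\<not> ?thesis"
  let ?k = "wmult \<theta> E w S"
  have "[:-\<theta>, 1:] ^ ?k dvd wpoly E w (S - {u})" if "u \<in> S" for u
    using neg that wmult_le_Suc[OF fin that, of \<theta> E w] by (fastforce simp: order_divides wmult_def)
  then have dvd: "[:-\<theta>, 1:] ^ ?k dvd pderiv (wpoly E w S)"
    unfolding pderiv_wpoly[OF fin] by (rule dvd_sum)
  have "degree (wpoly E w S) \<noteq> 0"
    using pos wpoly_nonzero[OF fin, of E w] order_degree[of "wpoly E w S" \<theta>] by (auto simp: wmult_def)
  then have "pderiv (wpoly E w S) \<noteq> 0" by (simp add: pderiv_eq_0_iff)
  then have "?k \<le> order \<theta> (pderiv (wpoly E w S))" using dvd by (simp add: order_divides)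
  moreover have "?k = Suc (order \<theta> (pderiv (wpoly E w S)))"
    unfolding wmult_def using pos wpoly_nonzero[OF fin, of E w] \<open>pderiv _ \<noteq> 0\<close>
    by (intro order_pderiv) (auto simp: wmult_def order_root)
  ultimately show False by simp
qed

subsection \<open>Critical components\<close>

abbreviation gmult :: "real \<Rightarrow> 'a graph \<Rightarrow> 'a set \<Rightarrow> nat" where
  "gmult \<theta> G S \<equiv> wmult \<theta> (edges G) (\<lambda>_. 0) S"

section \<open>Translation to graphs, and critical graphs\<close>

lemma card_Union_matching:
  assumes "M \<in> matchings_on E S" "finite S"
  shows "card (\<Union>M) = 2 * card M"
proof -
  have M: "\<forall>e\<in>M. finite e \<and> card e = 2" "pairwise disjnt M"
    using assms by (auto simp: matchings_on_def intro: finite_subset)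
  then have "card (\<Union>M) = sum card M" by (intro card_Union_disjoint) auto
  then show ?thesis using M(1) by simp
qed

lemma edge_verts:
  assumes "simple_graph G" "{u, v} \<in> edges G"
  shows "u \<noteq> v" "u \<in> verts G" "v \<in> verts G"
  using assms by (fastforce simp: simple_graph_def doubleton_eq_iff)+

text \<open>Group the matchings by size: one with r edges covers 2r vertices, hence r is at most
  half of n and the product over uncovered vertices is x^(n - 2r).\<close>

lemma match_poly_eq_wpoly:
  assumes "simple_graph G"
  shows "match_poly G = wpoly (edges G) (\<lambda>_. 0) (verts G)"
proof -
  let ?n = "card (verts G)" and ?M = "matchings_on (edges G) (verts G)"
  have fin: "finite (verts G)" using assms by (simp add: simple_graph_def)
  have E: "e \<subseteq> verts G \<and> card e = 2" if "e \<in> edges G" for e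
  proof -
    obtain u v where "e = {u, v}" "u \<noteq> v" "u \<in> verts G" "v \<in> verts G"
      using assms \<open>e \<in> edges G\<close> unfolding simple_graph_def by blast
    then show ?thesis by simp
  qed
  have mm: "matchings G r = {M \<in> ?M. card M = r}" for r
  proof -
    have "{e \<in> edges G. e \<subseteq> verts G \<and> card e = 2} = edges G" using E by auto
    then show ?thesis by (auto simp: matchings_def matchings_on_def pairwise_def disjnt_def)
  qed
  have le: "2 * card M \<le> ?n" if "M \<in> ?M" for M
  proof -
    have "\<Union>M \<subseteq> verts G" using that by (auto simp: matchings_on_def)
    then show ?thesis using card_Union_matching[OF that fin] card_mono[OF fin] by metis
  qed
  have summand: "(-1) ^ card M * (\<Prod>v\<in>verts G - \<Union>M. [:0, 1::real:])
      = monom ((-1) ^ card M) (?n - 2 * card M)" if "M \<in> ?M" for M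
  proof -
    have sub: "\<Union>M \<subseteq> verts G" using that by (auto simp: matchings_on_def)
    have "card (verts G - \<Union>M) = ?n - 2 * card M"
      using card_Union_matching[OF that fin] card_Diff_subset[OF finite_subset[OF sub fin] sub] by simp
    moreover have "(-1) ^ k * p = smult ((-1) ^ k) p" for k and p :: "real poly"
      by (induction k) auto
    ultimately show ?thesis by (simp add: monom_altdef)
  qed
  have "wpoly (edges G) (\<lambda>_. 0) (verts G) = (\<Sum>M\<in>?M. monom ((-1) ^ card M) (?n - 2 * card M))"
    unfolding wpoly_def by (rule sum.cong[OF refl summand])
  also have "\<dots> = (\<Sum>r\<le>?n div 2. \<Sum>M | M \<in> ?M \<and> card M = r. monom ((-1) ^ card M) (?n - 2 * card M))"
    using le fin by (intro sum.group[symmetric] finite_matchings_on) force+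
  also have "\<dots> = match_poly G"
    unfolding match_poly_def pmatch_def mm
    by (intro sum.cong refl) (simp add: of_nat_monom mult_monom mult.commute)
  finally show ?thesis by simp
qed

lemma mult_eq_gmult: "simple_graph G \<Longrightarrow> mult \<theta> G = gmult \<theta> G (verts G)"
  by (simp add: mult_def wmult_def match_poly_eq_wpoly)

lemma simple_graph_del: "simple_graph G \<Longrightarrow> simple_graph (del G X)"
  by (fastforce simp: simple_graph_def del_def verts_def edges_def)

lemma simple_graph_induced:
  assumes G: "simple_graph G" and C: "C \<subseteq> verts G"
  shows "simple_graph (induced G C)"
  unfolding simple_graph_def
proof (intro conjI ballI)
  show "finite (verts (induced G C))"
    using G C by (auto simp: simple_graph_def induced_def verts_def intro: finite_subset)
next
  fix e assume "e \<in> edges (induced G C)"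
  then have e: "e \<in> edges G" "e \<subseteq> C" by (auto simp: induced_def edges_def)
  then obtain u v where "e = {u, v}" "u \<noteq> v" using G by (fastforce simp: simple_graph_def)
  then show "\<exists>u v. e = {u, v} \<and> u \<noteq> v \<and> u \<in> verts (induced G C) \<and> v \<in> verts (induced G C)"
    using e by (auto simp: induced_def verts_def)
qed

lemma verts_del [simp]: "verts (del G X) = verts G - X"
  by (simp add: del_def verts_def)

lemma verts_induced [simp]: "verts (induced G C) = C"
  by (simp add: induced_def verts_def)

text \<open>Only edges inside \<open>S\<close> count, so multiplicities of subgraphs can all be
  computed with the edges of \<open>G\<close>.\<close>

lemma gmult_del: "S \<inter> X = {} \<Longrightarrow> gmult \<theta> (del G X) S = gmult \<theta> G S"
  unfolding wmult_def by (subst wpoly_cong[of S _ "\<lambda>_. 0" _ "edges G"]) (auto simp: del_def edges_def)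

lemma gmult_induced: "S \<subseteq> C \<Longrightarrow> gmult \<theta> (induced G C) S = gmult \<theta> G S"
  unfolding wmult_def by (subst wpoly_cong[of S _ "\<lambda>_. 0" _ "edges G"]) (auto simp: induced_def edges_def)

lemma mult_del: "simple_graph G \<Longrightarrow> mult \<theta> (del G X) = gmult \<theta> G (verts G - X)"
  by (subst mult_eq_gmult) (auto intro: gmult_del simple_graph_del)

lemma mult_induced: "simple_graph G \<Longrightarrow> C \<subseteq> verts G \<Longrightarrow> mult \<theta> (induced G C) = gmult \<theta> G C"
  by (simp add: mult_eq_gmult[OF simple_graph_induced] gmult_induced)

lemma essential_iff:
  "simple_graph G \<Longrightarrow> essential \<theta> G u \<longleftrightarrow> gmult \<theta> G (verts G) = Suc (gmult \<theta> G (verts G - {u}))"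
  by (auto simp: essential_def mult_del mult_eq_gmult)

text \<open>This is the analogue of Gallai's lemma. If the multiplicity were \<open>j + 2\<close>,
  then \<open>j + 1\<close> would persist after deleting \<open>u\<close> together with any vertex
  reachable from \<open>u\<close>, against an essential vertex \<open>v\<close> of the rest.\<close>

lemma critical_mult:
  assumes G: "simple_graph G" and crit: "critical \<theta> G"
  shows "mult \<theta> G = 1"
proof (rule ccontr)
  assume neq: "mult \<theta> G \<noteq> 1"
  let ?V = "verts G"
  have fin: "finite ?V" using G by (simp add: simple_graph_def)
  have ess: "gmult \<theta> G ?V = Suc (gmult \<theta> G (?V - {x}))" if "x \<in> ?V" for x
    using crit that by (simp add: critical_def essential_iff[OF G])
  obtain u where u: "u \<in> ?V" using crit by (auto simp: critical_def connected_graph_def)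
  obtain j where j: "gmult \<theta> G ?V = Suc (Suc j)"
    using neq ess[OF u] by (cases "gmult \<theta> G (?V - {u})") (auto simp: mult_eq_gmult[OF G])
  then have ess': "gmult \<theta> G (?V - {x}) = Suc j" if "x \<in> ?V" for x using ess[OF that] by simp
  obtain v where v: "v \<in> ?V - {u}" "gmult \<theta> G (?V - {u, v}) = j"
    using exists_essential[of "?V - {u}" \<theta> "edges G" "\<lambda>_. 0"] fin ess'[OF u]
    by (auto simp: Diff_Diff_singleton insert_commute)
  \<comment> \<open>Invariant along a walk from \<open>u\<close>: an edge step is
    \<open>adjacent_essential\<close>, and \<open>essential_pair_trans\<close> joins it to the walk
    so far. The case \<open>x = u\<close> is separate because the bound concerns pairs of distinct
    vertices.\<close>
  have "x \<in> ?V \<and> (x = u \<or> Suc j \<le> gmult \<theta> G (?V - {u, x}))" if "reach G u x" for x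
    using that unfolding reach_def
  proof (induction rule: rtranclp_induct)
    case base
    then show ?case using u by simp
  next
    case (step x y)
    note e = edge_verts[OF G step.hyps(2)]
    have xy: "Suc j \<le> gmult \<theta> G (?V - {x, y})"
      using adjacent_essential[OF fin e(2,3,1) step.hyps(2) j] ess' e by simp
    consider "y = u" | "x = u" | "y \<noteq> u" "x \<noteq> u" by blast
    then show ?case
    proof cases
      case 3
      then have "Suc j \<le> gmult \<theta> G (?V - {u, y})"
        using step.IH e xy j ess' u fin by (intro essential_pair_trans[of _ u x y]) auto
      then show ?thesis using e by simp
    qed (use e xy in auto)
  qed
  moreover have "reach G u v" using crit u v by (auto simp: critical_def connected_graph_def)
  ultimately have "v = u \<or> Suc j \<le> gmult \<theta> G (?V - {u, v})" by blast
  then show False using v by simp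
qed

section \<open>Components and the count of critical ones\<close>

lemma reach_sym: "reach G u v \<Longrightarrow> reach G v u"
  unfolding reach_def
proof (induction rule: rtranclp_induct)
  case (step y z)
  then have "{z, y} \<in> edges G" by (simp add: insert_commute)
  then show ?case using step.IH by (rule converse_rtranclp_into_rtranclp)
qed simp

lemma reach_trans: "reach G u v \<Longrightarrow> reach G v x \<Longrightarrow> reach G u x"
  unfolding reach_def by (rule rtranclp_trans)

lemma reach_edge: "{u, v} \<in> edges G \<Longrightarrow> reach G u v"
  unfolding reach_def by blast

lemma component_subset: "C \<in> components G \<Longrightarrow> C \<subseteq> verts G"
  by (auto simp: components_def)

lemma component_eq:
  assumes "C \<in> components G" "x \<in> C"
  shows "C = {y \<in> verts G. reach G x y}"
  using assms unfolding components_def by (auto intro: reach_trans reach_sym)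

lemma component_nonempty: "C \<in> components G \<Longrightarrow> C \<noteq> {}"
  by (auto simp: components_def reach_def)

lemma component_closed:
  assumes "simple_graph G" "C \<in> components G" "x \<in> C" "{x, y} \<in> edges G"
  shows "y \<in> C"
  using component_eq[OF assms(2,3)] reach_edge[OF assms(4)] edge_verts[OF assms(1,4)] by simp

lemma Union_components: "\<Union>(components G) = verts G"
  by (auto simp: components_def reach_def)

lemma finite_components: "simple_graph G \<Longrightarrow> finite (components G)"
  by (simp add: components_def simple_graph_def)

lemma gmult_Un:
  assumes "finite A" "finite B" "A \<inter> B = {}" "\<And>a b. a \<in> A \<Longrightarrow> b \<in> B \<Longrightarrow> {a, b} \<notin> edges G"
  shows "gmult \<theta> G (A \<union> B) = gmult \<theta> G A + gmult \<theta> G B"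
proof -
  have "wpoly (edges G) (\<lambda>_. 0) (A \<union> B) = wpoly (edges G) (\<lambda>_. 0) A * wpoly (edges G) (\<lambda>_. 0) B"
    using assms by (intro wpoly_Un) auto
  then show ?thesis using assms(1,2) by (simp add: wmult_def order_mult wpoly_nonzero)
qed

text \<open>Stated for subfamilies so that the induction can add one component at a time.\<close>

lemma gmult_Union_components:
  assumes G: "simple_graph G" and "D \<subseteq> components G"
  shows "gmult \<theta> G (\<Union>D) = (\<Sum>C\<in>D. gmult \<theta> G C)"
proof -
  have fin: "finite (verts G)" using G by (simp add: simple_graph_def)
  have "finite D" using assms finite_components finite_subset by blast
  then show ?thesis using assms(2)
  proof (induction D rule: finite_induct)
    case empty
    have "order \<theta> (1 :: real poly) = 0" by (simp add: order_root)
    then show ?case by (simp add: wmult_def)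
  next
    case (insert C D)
    have "C \<inter> C' = {}" if "C' \<in> D" for C'
    proof (rule ccontr)
      assume "C \<inter> C' \<noteq> {}"
      then obtain x where "x \<in> C" "x \<in> C'" by blast
      then have "C = C'" using component_eq[of C G x] component_eq[of C' G x] insert.prems that by blast
      then show False using insert.hyps that by simp
    qed
    then have dj: "C \<inter> \<Union>D = {}" by blast
    have "gmult \<theta> G (C \<union> \<Union>D) = gmult \<theta> G C + gmult \<theta> G (\<Union>D)"
    proof (rule gmult_Un)
      show "finite C" "finite (\<Union>D)"
        using insert.prems component_subset[of _ G] by (auto intro!: finite_subset[OF _ fin])
      show "{a, b} \<notin> edges G" if "a \<in> C" "b \<in> \<Union>D" for a b
        using component_closed[OF G, of C a b] that dj insert.prems by blast
    qed (rule dj)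
    then show ?case using insert by simp
  qed
qed

text \<open>Comparing \<open>X = {x}\<close> with the empty \<open>X\<close> shows that deleting
  \<open>x\<close> changes the multiplicity in its component exactly as in \<open>G\<close>.\<close>

lemma gmult_remove_component:
  assumes G: "simple_graph G" and C: "C \<in> components G" and "X \<subseteq> C"
  shows "gmult \<theta> G (verts G - X) = gmult \<theta> G (C - X) + gmult \<theta> G (verts G - C)"
proof -
  have fin: "finite (verts G)" using G by (simp add: simple_graph_def)
  have "verts G - X = (C - X) \<union> (verts G - C)" using assms(3) component_subset[OF C] by auto
  moreover have "gmult \<theta> G ((C - X) \<union> (verts G - C)) = gmult \<theta> G (C - X) + gmult \<theta> G (verts G - C)"
    using fin component_subset[OF C] component_closed[OF G C]
    by (intro gmult_Un) (auto intro: finite_subset)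
  ultimately show ?thesis by simp
qed

lemma connected_component:
  assumes G: "simple_graph G" and C: "C \<in> components G"
  shows "connected_graph (induced G C)"
proof -
  have "y \<in> C \<and> reach (induced G C) x y" if "x \<in> C" "reach G x y" for x y
    using that(2) unfolding reach_def
  proof (induction rule: rtranclp_induct)
    case (step y z)
    then have "z \<in> C" using component_closed[OF G C] by blast
    then have "{y, z} \<in> edges (induced G C)" using step by (simp add: induced_def edges_def)
    then show ?case using step.IH \<open>z \<in> C\<close> by (auto intro: rtranclp.rtrancl_into_rtrancl)
  qed (use that in simp)
  then show ?thesis
    unfolding connected_graph_def using component_nonempty[OF C] component_eq[OF C] by auto
qed

lemma mult_component:
  assumes "simple_graph G" and "C \<in> components G"
  shows "mult \<theta> (induced G C) = gmult \<theta> G C" "simple_graph (induced G C)"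
  using mult_induced[OF assms(1) component_subset[OF assms(2)]]
    simple_graph_induced[OF assms(1) component_subset[OF assms(2)]] by auto

lemma mult_eq_sum_components:
  assumes "simple_graph G"
  shows "mult \<theta> G = (\<Sum>C\<in>components G. mult \<theta> (induced G C))"
  using gmult_Union_components[OF assms order_refl, of \<theta>] assms
  by (simp add: Union_components mult_eq_gmult[OF assms] mult_component)

lemma c_crit_eq_sum:
  assumes "simple_graph G"
  shows "c_crit \<theta> G = (\<Sum>C\<in>components G. if critical \<theta> (induced G C) then 1 else 0)"
  unfolding c_crit_def using finite_components[OF assms]
  by (simp add: sum.If_cases Int_def)

text \<open>By \<open>critical_mult\<close> each critical component contributes exactly 1 to the
  multiplicity.\<close>

lemma c_crit_le_mult:
  assumes "simple_graph G"
  shows "c_crit \<theta> G \<le> mult \<theta> G"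
  unfolding c_crit_eq_sum[OF assms] mult_eq_sum_components[OF assms]
  using critical_mult[OF mult_component(2)[OF assms]] by (intro sum_mono) simp

text \<open>A component with root \<theta> has an essential vertex, and essentiality spreads along
  edges, since \<open>special_imp_positive\<close> would turn an exception into a vertex that raises
  the multiplicity. So each such component is critical and counts 1 on both sides.\<close>

lemma c_crit_eq_mult:
  assumes G: "simple_graph G"
    and np: "\<And>u. u \<in> verts G \<Longrightarrow> mult \<theta> (del G {u}) \<le> mult \<theta> G"
  shows "c_crit \<theta> G = mult \<theta> G"
  unfolding c_crit_eq_sum[OF G] mult_eq_sum_components[OF G]
proof (rule sum.cong[OF refl])
  fix C assume C: "C \<in> components G"
  let ?H = "induced G C"
  have H: "simple_graph ?H" by (rule mult_component(2)[OF G C])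
  have CV: "C \<subseteq> verts G" by (rule component_subset[OF C])
  then have fin: "finite C" using G by (auto simp: simple_graph_def intro: finite_subset)
  have ess: "essential \<theta> ?H x \<longleftrightarrow> gmult \<theta> G C = Suc (gmult \<theta> G (C - {x}))" for x
    using essential_iff[OF H, of \<theta> x] by (simp add: gmult_induced)
  have np': "gmult \<theta> G (C - {x}) \<le> gmult \<theta> G C" if "x \<in> C" for x
    using np[of x] that CV gmult_remove_component[OF G C, of "{x}" \<theta>]
      gmult_remove_component[OF G C, of "{}" \<theta>] by (auto simp: mult_del[OF G] mult_eq_gmult[OF G])
  have "critical \<theta> ?H" if pos: "gmult \<theta> G C > 0"
  proof -
    obtain d where d: "d \<in> C" "gmult \<theta> G C = Suc (gmult \<theta> G (C - {d}))"
      using exists_essential[OF fin pos] by blast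
    have "x \<in> C \<and> gmult \<theta> G C = Suc (gmult \<theta> G (C - {x}))" if "reach G d x" for x
      using that unfolding reach_def
    proof (induction rule: rtranclp_induct)
      case (step x y)
      have y: "y \<in> C" using component_closed[OF G C] step by blast
      have "gmult \<theta> G C = Suc (gmult \<theta> G (C - {y}))"
      proof (rule ccontr)
        assume "gmult \<theta> G C \<noteq> Suc (gmult \<theta> G (C - {y}))"
        then have "gmult \<theta> G (C - {y}) = Suc (gmult \<theta> G C)"
          using step y edge_verts[OF G step.hyps(2)] fin
          by (intro special_imp_positive[of C y x]) (auto simp: insert_commute)
        then show False using np'[OF y] by simp
      qed
      then show ?case using y by simp
    qed (use d in simp)
    then show ?thesis
      unfolding critical_def using connected_component[OF G C] component_eq[OF C d(1)] ess by auto
  qed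
  moreover have "\<not> critical \<theta> ?H" if "gmult \<theta> G C = 0"
    using that component_nonempty[OF C] ess by (auto simp: critical_def)
  ultimately show "(if critical \<theta> ?H then 1 else 0) = mult \<theta> ?H"
    using critical_mult[OF H] mult_component(1)[OF G C] by (cases "gmult \<theta> G C = 0") auto
qed

section \<open>Comparison of maximal Tutte, extreme and nice sets\<close>

lemma maximal_wrt_exists:
  assumes "finite (verts G)" "P X" and sub: "\<And>Y. P Y \<Longrightarrow> Y \<subseteq> verts G"
  obtains Z where "X \<subseteq> Z" "maximal_wrt P G Z"
proof -
  have "finite {Y. P Y}" by (rule finite_subset[of _ "Pow (verts G)"]) (use assms in auto)
  then have "\<exists>Z\<in>{Y. P Y}. X \<subseteq> Z \<and> (\<forall>Y\<in>{Y. P Y}. Z \<subseteq> Y \<longrightarrow> Z = Y)"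
    by (rule finite_has_maximal2) (simp add: assms(2))
  then obtain Z where Z: "P Z" "X \<subseteq> Z" "\<forall>Y. P Y \<longrightarrow> Z \<subseteq> Y \<longrightarrow> Z = Y"
    by (simp add: Bex_def) metis
  have "maximal_wrt P G Z"
    unfolding maximal_wrt_def psubset_eq using Z(1,3) by metis
  then show ?thesis using that Z(2) by simp
qed

text \<open>The multiplicity of \<open>del G X\<close> is squeezed between the number of critical
  components and the interlacing bound, which coincide here.\<close>

lemma tutte_imp_extreme:
  assumes G: "simple_graph G" and "tutte_set \<theta> G X"
  shows "extreme_set \<theta> G X"
proof -
  have X: "X \<subseteq> verts G" "c_crit \<theta> (del G X) = mult \<theta> G + card X"
    using assms(2) by (auto simp: tutte_set_def)
  have fin: "finite (verts G)" using G by (simp add: simple_graph_def)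
  have "mult \<theta> (del G X) \<le> mult \<theta> G + card X"
    using wmult_le_Diff[OF fin finite_subset[OF X(1) fin] empty_subsetI X(1), of \<theta> "edges G" "\<lambda>_. 0"]
    by (simp add: mult_del[OF G] mult_eq_gmult[OF G])
  moreover have "c_crit \<theta> (del G X) \<le> mult \<theta> (del G X)"
    using G by (intro c_crit_le_mult simple_graph_del)
  ultimately show ?thesis using X by (simp add: extreme_set_def)
qed

text \<open>A vertex outside \<open>X\<close> that raised the multiplicity of \<open>del G X\<close>
  could be added to \<open>X\<close>. By maximality there is none, so \<open>c_crit_eq_mult\<close>
  applies.\<close>

lemma maximal_extreme_imp_tutte:
  assumes G: "simple_graph G" and "maximal_wrt (extreme_set \<theta> G) G X"
  shows "tutte_set \<theta> G X"
proof -
  have X: "X \<subseteq> verts G" "mult \<theta> (del G X) = mult \<theta> G + card X"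
    using assms(2) by (auto simp: maximal_wrt_def extreme_set_def)
  have fin: "finite (verts G)" using G by (simp add: simple_graph_def)
  have "c_crit \<theta> (del G X) = mult \<theta> (del G X)"
  proof (rule c_crit_eq_mult)
    fix u assume "u \<in> verts (del G X)"
    then have u: "u \<in> verts G - X" by simp
    then have "\<not> extreme_set \<theta> G (insert u X)"
      using assms(2) X(1) unfolding maximal_wrt_def by blast
    then have "gmult \<theta> G (verts G - insert u X) \<noteq> Suc (gmult \<theta> G (verts G - X))"
      using u X finite_subset[OF X(1) fin] by (auto simp: extreme_set_def mult_del[OF G])
    moreover have "gmult \<theta> G (verts G - insert u X) \<le> Suc (gmult \<theta> G (verts G - X))"
      using fin u by (rule wmult_Diff_insert_le_Suc)
    moreover have "mult \<theta> (del (del G X) {u}) = gmult \<theta> G (verts G - insert u X)"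
      using gmult_del[of "verts G - insert u X" X \<theta> G]
      by (auto simp: mult_del[OF simple_graph_del[OF G]] Diff_Diff_singleton)
    ultimately show "mult \<theta> (del (del G X) {u}) \<le> mult \<theta> (del G X)"
      by (simp add: mult_del[OF G])
  qed (use G in \<open>rule simple_graph_del\<close>)
  then show ?thesis using X by (simp add: tutte_set_def)
qed

text \<open>Each deletion gains at most 1, so a total gain of \<open>card X\<close> leaves no room
  for a pair that gains less than 2.\<close>

lemma extreme_imp_nice:
  assumes G: "simple_graph G" and "extreme_set \<theta> G X"
  shows "nice_set \<theta> G X"
proof -
  have X: "X \<subseteq> verts G" "gmult \<theta> G (verts G - X) = gmult \<theta> G (verts G) + card X"
    using assms(2) by (auto simp: extreme_set_def mult_del[OF G] mult_eq_gmult[OF G])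
  have fin: "finite (verts G)" using G by (simp add: simple_graph_def)
  have finX: "finite X" using X(1) fin by (rule finite_subset)
  have "gmult \<theta> G (verts G - {u, v}) = gmult \<theta> G (verts G) + 2" if uv: "u \<in> X" "v \<in> X" "u \<noteq> v" for u v
  proof -
    have "gmult \<theta> G (verts G - X) \<le> gmult \<theta> G (verts G - {u, v}) + card (X - {u, v})"
      using uv X(1) by (intro wmult_le_Diff fin finX) auto
    moreover have "card X = card (X - {u, v}) + 2"
      using uv card_Diff_subset[of "{u, v}" X] card_mono[OF finX, of "{u, v}"] by simp
    moreover have "gmult \<theta> G (verts G - {u, v}) \<le> gmult \<theta> G (verts G) + 2"
      using wmult_le_Diff[of "verts G" "{u, v}" "{}" \<theta> "edges G" "\<lambda>_. 0"] uv X(1) fin by auto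
    ultimately show ?thesis using X(2) by linarith
  qed
  then show ?thesis using X(1) by (simp add: nice_set_def mult_del[OF G] mult_eq_gmult[OF G])
qed

text \<open>The size condition matters, since every singleton is nice vacuously.\<close>

lemma nice_set_imp_extreme_set:
  assumes G: "simple_graph G" and "nice_set \<theta> G X" and "card X > 1"
  shows "extreme_set \<theta> G X"
proof -
  have "X \<subseteq> verts G" using assms(2) by (simp add: nice_set_def)
  moreover have "gmult \<theta> G (verts G - X) = gmult \<theta> G (verts G) + card X"
    using assms by (intro wmult_Diff_of_pairs)
      (auto simp: nice_set_def simple_graph_def mult_del[OF G] mult_eq_gmult[OF G])
  ultimately show ?thesis by (simp add: extreme_set_def mult_del[OF G] mult_eq_gmult[OF G])
qed

theorem theorem3p6:
  fixes G :: "'a graph" and \<theta> :: real and X :: "'a set"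
  assumes "simple_graph G" and "X \<subseteq> verts G" and "card X > 1"
  shows "(maximal_wrt (tutte_set \<theta> G) G X \<longleftrightarrow> maximal_wrt (extreme_set \<theta> G) G X)
       \<and> (maximal_wrt (extreme_set \<theta> G) G X \<longleftrightarrow> maximal_wrt (nice_set \<theta> G) G X)"
proof (intro conjI iffI)
  note G = assms(1)
  have fin: "finite (verts G)" using G by (simp add: simple_graph_def)
  have sub: "Y \<subseteq> verts G" if "extreme_set \<theta> G Y" for Y using that by (simp add: extreme_set_def)
  show "maximal_wrt (extreme_set \<theta> G) G X" if max: "maximal_wrt (tutte_set \<theta> G) G X"
  proof -
    have "extreme_set \<theta> G X" using max G by (auto simp: maximal_wrt_def intro: tutte_imp_extreme)
    \<comment> \<open>Enlarge \<open>X\<close> to a maximal extreme set \<open>Z\<close>. It is a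
      Tutte set, so the maximality of \<open>X\<close> among Tutte sets forces
      \<open>Z = X\<close>.\<close>
    then obtain Z where Z: "X \<subseteq> Z" "maximal_wrt (extreme_set \<theta> G) G Z"
      using maximal_wrt_exists[OF fin _ sub] by metis
    then have "tutte_set \<theta> G Z" "Z \<subseteq> verts G"
      using maximal_extreme_imp_tutte[OF G] sub by (auto simp: maximal_wrt_def)
    then have "Z = X" using max Z(1) unfolding maximal_wrt_def by blast
    then show ?thesis using Z(2) by simp
  qed
  show "maximal_wrt (tutte_set \<theta> G) G X" if "maximal_wrt (extreme_set \<theta> G) G X"
    using that maximal_extreme_imp_tutte[OF G that] tutte_imp_extreme[OF G]
    unfolding maximal_wrt_def by blast
  \<comment> \<open>Maximality of \<open>X\<close> is tested on supersets of \<open>X\<close> only,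
    and these also have more than one element.\<close>
  have nice_iff: "nice_set \<theta> G Y \<longleftrightarrow> extreme_set \<theta> G Y" if "X \<subseteq> Y" "Y \<subseteq> verts G" for Y
  proof -
    have "card Y > 1" using assms(3) card_mono[OF finite_subset[OF that(2) fin] that(1)] by simp
    then show ?thesis using extreme_imp_nice[OF G] nice_set_imp_extreme_set[OF G] by metis
  qed
  have iff: "maximal_wrt (extreme_set \<theta> G) G X \<longleftrightarrow> maximal_wrt (nice_set \<theta> G) G X"
    unfolding maximal_wrt_def using nice_iff assms(2) by (metis order_refl psubset_imp_subset)
  from iff show "maximal_wrt (nice_set \<theta> G) G X" if "maximal_wrt (extreme_set \<theta> G) G X"
    using that by simp
  show "maximal_wrt (extreme_set \<theta> G) G X" if "maximal_wrt (nice_set \<theta> G) G X"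
    using that iff by simp
qed

end
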